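(* Let $k\in\mathbb{N}$ and let $\mathbf{N}=(N_1,\ldots,N_{2^k})$ be a tuple of normal subgroups of a group $G$. If $\delta_k\{\mathbf{N}\}$ is finite of order $m$, then the subgroup $\delta_k(\mathbf{N})$ is also finite, of $(m,k)$-bounded order.
   Context: $\mathbb{N}$ denotes the positive integers. For a word $w=w(x_1,\ldots,x_r)$ and a tuple $\mathbf{N}=(N_1,\ldots,N_r)$ of subgroups of $G$, $w\{\mathbf{N}\}=\{w(g_1,\ldots,g_r)\mid g_i\in N_i\}$ and $w(\mathbf{N})=\langle w\{\mathbf{N}\}\rangle$. Commutators are $[x,y]=x^{-1}y^{-1}xy$. The derived words are defined by $\delta_0=x_1$ and $\delta_k(x_1,\ldots,x_{2^k})=[\delta_{k-1}(x_1,\ldots,x_{2^{k-1}}),\delta_{k-1}(x_{2^{k-1}+1},\ldots,x_{2^k})]$. "$(m,k)$-bounded" means bounded by a function depending only on $m$ and $k$ (and not on $G$ or the $N_i$). *)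

theory Defs
  imports "HOL-Algebra.Algebra"
begin

text \<open>Group words are represented by terms; two terms that denote the same element of the free
  group have the same value under every evaluation in a group.\<close>

datatype 'v gword = GOne | GVar 'v | GMult "'v gword" "'v gword" | GInv "'v gword"

fun geval :: "('a, 'b) monoid_scheme \<Rightarrow> ('v \<Rightarrow> 'a) \<Rightarrow> 'v gword \<Rightarrow> 'a" where
  "geval G g GOne = \<one>\<^bsub>G\<^esub>"
| "geval G g (GVar i) = g i"
| "geval G g (GMult u v) = geval G g u \<otimes>\<^bsub>G\<^esub> geval G g v"
| "geval G g (GInv u) = inv\<^bsub>G\<^esub> (geval G g u)"

text \<open>The convention is \<open>[u, v] = u\<inverse> v\<inverse> u v\<close>.\<close>

definition gcomm :: "'v gword \<Rightarrow> 'v gword \<Rightarrow> 'v gword" where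
  "gcomm u v = GMult (GMult (GMult (GInv u) (GInv v)) u) v"

text \<open>The variables of \<open>delta_word k\<close> are numbered from \<open>1\<close> to \<open>2 ^ k\<close>.\<close>

fun delta_word :: "nat \<Rightarrow> nat gword" where
  "delta_word 0 = GVar 1"
| "delta_word (Suc k) = gcomm (delta_word k) (map_gword (\<lambda>i. 2 ^ k + i) (delta_word k))"

text \<open>For a word \<open>w\<close> in the variables \<open>1, \<dots>, r\<close> and a tuple \<open>N 1, \<dots>, N r\<close> of subgroups of \<open>G\<close>, the
  set \<open>w{N}\<close> of values and the subgroup \<open>w(N)\<close> they generate.\<close>

definition word_values ::
    "('a, 'b) monoid_scheme \<Rightarrow> nat gword \<Rightarrow> nat \<Rightarrow> (nat \<Rightarrow> 'a set) \<Rightarrow> 'a set" where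
  "word_values G w r N = {geval G g w | g. \<forall>i\<in>{1..r}. g i \<in> N i}"

definition word_subgroup ::
    "('a, 'b) monoid_scheme \<Rightarrow> nat gword \<Rightarrow> nat \<Rightarrow> (nat \<Rightarrow> 'a set) \<Rightarrow> 'a set" where
  "word_subgroup G w r N = generate G (word_values G w r N)"

text \<open>HOL cannot quantify over types inside a formula, so a bound introduced by an existential
  quantifier in a theorem about groups on \<open>'a\<close> could depend on \<open>'a\<close>, hence on the group (on a
  finite type, \<open>CARD('a)\<close> would do). The bounding function is therefore a constant whose type does
  not mention \<open>'a\<close>: some function that works for all groups with carrier in \<open>nat\<close>, if there is one.
  That one exists is not assumed. A theorem asserting that \<open>delta_bound\<close> bounds the orders for
  groups on an arbitrary type \<open>'a\<close> includes the case \<open>'a = nat\<close>, and so asserts existence as well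
  as uniformity.\<close>

definition bounds_delta_orders :: "'a itself \<Rightarrow> (nat \<Rightarrow> nat \<Rightarrow> nat) \<Rightarrow> bool" where
  "bounds_delta_orders (_ :: 'a itself) f \<longleftrightarrow>
    (\<forall>(G :: 'a monoid) N k m. group G \<longrightarrow> k \<ge> 1 \<longrightarrow> (\<forall>i\<in>{1..2 ^ k}. N i \<lhd> G) \<longrightarrow>
       finite (word_values G (delta_word k) (2 ^ k) N) \<longrightarrow>
       card (word_values G (delta_word k) (2 ^ k) N) = m \<longrightarrow>
       finite (word_subgroup G (delta_word k) (2 ^ k) N) \<and>
       card (word_subgroup G (delta_word k) (2 ^ k) N) \<le> f m k)"

definition delta_bound :: "nat \<Rightarrow> nat \<Rightarrow> nat" where
  "delta_bound = (SOME f. bounds_delta_orders TYPE(nat) f)"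

end

theory Submission
  imports Defs
begin

text \<open>Let \<open>X\<close> be the set of values and \<open>W\<close> the subgroup it generates. By Schur's theorem \<open>W'\<close> is finite.
  If \<open>M\<close> is a tuple of normal subgroups with \<open>M i \<subseteq> N i\<close>, and \<open>V\<close> is the product of the subgroups
  \<open>\<delta>\<^sub>k(M)\<close> with one \<open>M l\<close> replaced by \<open>[M l, M j]\<close>, for a fixed \<open>j\<close>, then modulo \<open>V\<close> all powers of
  values on \<open>M\<close> are values. So if \<open>V\<close> is finite, then these values have bounded order, and \<open>\<delta>\<^sub>k(M)\<close> is
  finite by Dietzmann's lemma. Starting from \<open>W'\<close>, this step climbs to \<open>N\<close> through tuples built from
  intersections of the \<open>N i\<close> and their derived subgroups.\<close>

section \<open>Commutators of normal subgroups\<close>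

text \<open>Replacing entries by commutators [M l, M j] produces ever smaller tuples, and the
  difficulty is that nothing ends this descent: at the start only W' is known to be finite. What
  ends it is a normal subgroup A contained in at least one entry, whose derived series is followed
  to depth k + 1. If A lies in every entry, then A^(k) lies in W, so A^(k+1) lies in W'. Otherwise
  the three subgroups lemma trades A^(k+1) for intersections of A with entries that do not contain
  it, and such an intersection lies in strictly more entries than A. There are only 2^k entries, so
  the number of steps depends on k alone, and each step turns an order bound b into a function of b,
  m and k. A second obstacle is formal: \<open>delta_bound\<close> is chosen with regard to groups
  on \<open>nat\<close> only, so an explicit bound valid for every type does not yet bound orders by
  \<open>delta_bound\<close>, and the general case has to pass through a copy of a countable
  subgroup.\<close>

definition commutator :: "('a, 'b) monoid_scheme \<Rightarrow> 'a \<Rightarrow> 'a \<Rightarrow> 'a" where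
  "commutator G x y = inv\<^bsub>G\<^esub> x \<otimes>\<^bsub>G\<^esub> inv\<^bsub>G\<^esub> y \<otimes>\<^bsub>G\<^esub> x \<otimes>\<^bsub>G\<^esub> y"

definition comm_subgroup :: "('a, 'b) monoid_scheme \<Rightarrow> 'a set \<Rightarrow> 'a set \<Rightarrow> 'a set" where
  "comm_subgroup G A B = generate G {commutator G a b | a b. a \<in> A \<and> b \<in> B}"

context group
begin

section \<open>Commutator identities and the Hall-Witt identity\<close>

lemma inv_mult_cancel:
  "x \<in> carrier G \<Longrightarrow> y \<in> carrier G \<Longrightarrow> inv x \<otimes> (x \<otimes> y) = y"
  "x \<in> carrier G \<Longrightarrow> y \<in> carrier G \<Longrightarrow> x \<otimes> (inv x \<otimes> y) = y"
  by (simp_all add: m_assoc [symmetric])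

lemmas group_word_simps = m_assoc inv_mult_group inv_mult_cancel commutator_def

lemma commutator_closed [simp]:
  "x \<in> carrier G \<Longrightarrow> y \<in> carrier G \<Longrightarrow> commutator G x y \<in> carrier G"
  by (simp add: commutator_def)

lemma inv_commutator:
  "x \<in> carrier G \<Longrightarrow> y \<in> carrier G \<Longrightarrow> inv (commutator G x y) = commutator G y x"
  by (simp add: group_word_simps)

lemma commutator_mult_left:
  "x \<in> carrier G \<Longrightarrow> y \<in> carrier G \<Longrightarrow> z \<in> carrier G \<Longrightarrow>
   commutator G (x \<otimes> y) z = inv y \<otimes> commutator G x z \<otimes> y \<otimes> commutator G y z"
  by (simp add: group_word_simps)

lemma commutator_inv_left:
  "x \<in> carrier G \<Longrightarrow> z \<in> carrier G \<Longrightarrow>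
   commutator G (inv x) z = x \<otimes> inv (commutator G x z) \<otimes> inv x"
  by (simp add: group_word_simps)

lemma commutator_conj:
  "x \<in> carrier G \<Longrightarrow> y \<in> carrier G \<Longrightarrow> z \<in> carrier G \<Longrightarrow>
   commutator G (z \<otimes> x \<otimes> inv z) (z \<otimes> y \<otimes> inv z) = z \<otimes> commutator G x y \<otimes> inv z"
  by (simp add: group_word_simps)

text \<open>With P(x,y,z) = x^-1 y^-1 x z^-1 x^-1 the right-hand side is P(x,y,z) P(y,z,x)^-1, so
  the product over the three cyclic permutations telescopes.\<close>

lemma Hall_Witt_factor:
  assumes "x \<in> carrier G" "y \<in> carrier G" "z \<in> carrier G"
  shows "inv y \<otimes> commutator G (commutator G x (inv y)) z \<otimes> y =
    (inv x \<otimes> inv y \<otimes> x \<otimes> inv z \<otimes> inv x) \<otimes> inv (inv y \<otimes> inv z \<otimes> y \<otimes> inv x \<otimes> inv y)"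
proof -
  have "inv (commutator G x (inv y)) = y \<otimes> (inv x \<otimes> (inv y \<otimes> x))"
    "commutator G x (inv y) = inv x \<otimes> (y \<otimes> (x \<otimes> inv y))"
    using assms by (simp_all add: commutator_def m_assoc inv_mult_group)
  then show ?thesis
    unfolding commutator_def [of G "commutator G x (inv y)"]
    using assms by (simp add: m_assoc inv_mult_group inv_mult_cancel)
qed

lemma mult_inv_telescope:
  "a \<in> carrier G \<Longrightarrow> b \<in> carrier G \<Longrightarrow> c \<in> carrier G \<Longrightarrow>
   (a \<otimes> inv b) \<otimes> (b \<otimes> inv c) \<otimes> (c \<otimes> inv a) = \<one>"
  by (simp add: m_assoc inv_mult_cancel)

lemma Hall_Witt:
  assumes "x \<in> carrier G" "y \<in> carrier G" "z \<in> carrier G"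
  shows "(inv y \<otimes> commutator G (commutator G x (inv y)) z \<otimes> y) \<otimes>
   (inv z \<otimes> commutator G (commutator G y (inv z)) x \<otimes> z) \<otimes>
   (inv x \<otimes> commutator G (commutator G z (inv x)) y \<otimes> x) = \<one>"
  unfolding Hall_Witt_factor [OF assms] Hall_Witt_factor [OF assms(2,3,1)]
    Hall_Witt_factor [OF assms(3,1,2)]
  by (rule mult_inv_telescope) (intro m_closed inv_closed assms)+

section \<open>Commutator subgroups and the three subgroups lemma\<close>

lemma normal_conj:
  assumes "K \<lhd> G" "x \<in> K" "z \<in> carrier G"
  shows "z \<otimes> x \<otimes> inv z \<in> K" "inv z \<otimes> x \<otimes> z \<in> K"
  using normal.inv_op_closed2 [OF assms(1,3,2)] normal.inv_op_closed1 [OF assms(1,3,2)] .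

lemma normal_carrier: "K \<lhd> G \<Longrightarrow> K \<subseteq> carrier G"
  by (simp add: normal_imp_subgroup subgroup.subset)

lemma normal_generate:
  assumes "S \<subseteq> carrier G"
    and "\<And>x z. x \<in> S \<Longrightarrow> z \<in> carrier G \<Longrightarrow> z \<otimes> x \<otimes> inv z \<in> S"
  shows "generate G S \<lhd> G"
  using normal_generateI assms by blast

lemma comm_subgroup_carrier:
  "A \<subseteq> carrier G \<Longrightarrow> B \<subseteq> carrier G \<Longrightarrow> {commutator G a b | a b. a \<in> A \<and> b \<in> B} \<subseteq> carrier G"
  by (auto simp: subset_iff)

lemma commutator_in_comm_subgroup:
  "a \<in> A \<Longrightarrow> b \<in> B \<Longrightarrow> commutator G a b \<in> comm_subgroup G A B"
  unfolding comm_subgroup_def by (rule generate.incl) auto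

lemma comm_subgroup_subset_iff:
  assumes "subgroup K G"
  shows "comm_subgroup G A B \<subseteq> K \<longleftrightarrow> (\<forall>a\<in>A. \<forall>b\<in>B. commutator G a b \<in> K)"
proof
  assume "comm_subgroup G A B \<subseteq> K"
  then show "\<forall>a\<in>A. \<forall>b\<in>B. commutator G a b \<in> K"
    using commutator_in_comm_subgroup by (intro ballI) (rule subsetD)
next
  assume "\<forall>a\<in>A. \<forall>b\<in>B. commutator G a b \<in> K"
  then have "{commutator G a b | a b. a \<in> A \<and> b \<in> B} \<subseteq> K" by auto
  then show "comm_subgroup G A B \<subseteq> K"
    unfolding comm_subgroup_def using assms by (rule generate_subgroup_incl)
qed

lemma comm_subgroup_mono:
  "A \<subseteq> A' \<Longrightarrow> B \<subseteq> B' \<Longrightarrow> comm_subgroup G A B \<subseteq> comm_subgroup G A' B'"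
  unfolding comm_subgroup_def by (rule mono_generate) auto

lemma normal_comm_subgroup_gen:
  assumes "A \<subseteq> carrier G" "B \<subseteq> carrier G"
    and "\<And>x z. x \<in> A \<Longrightarrow> z \<in> carrier G \<Longrightarrow> z \<otimes> x \<otimes> inv z \<in> A"
    and "\<And>x z. x \<in> B \<Longrightarrow> z \<in> carrier G \<Longrightarrow> z \<otimes> x \<otimes> inv z \<in> B"
  shows "comm_subgroup G A B \<lhd> G"
  unfolding comm_subgroup_def
proof (rule normal_generate)
  show "{commutator G a b | a b. a \<in> A \<and> b \<in> B} \<subseteq> carrier G"
    using assms(1,2) by (rule comm_subgroup_carrier)
next
  fix x z assume "x \<in> {commutator G a b | a b. a \<in> A \<and> b \<in> B}" and z: "z \<in> carrier G"
  then obtain a b where ab: "x = commutator G a b" "a \<in> A" "b \<in> B" by auto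
  then have "z \<otimes> x \<otimes> inv z = commutator G (z \<otimes> a \<otimes> inv z) (z \<otimes> b \<otimes> inv z)"
    using assms(1,2) z by (simp add: commutator_conj subset_iff)
  then show "z \<otimes> x \<otimes> inv z \<in> {commutator G a b | a b. a \<in> A \<and> b \<in> B}"
    using assms(3) [OF ab(2) z] assms(4) [OF ab(3) z] by (intro CollectI exI conjI)
qed

lemma normal_comm_subgroup:
  "A \<lhd> G \<Longrightarrow> B \<lhd> G \<Longrightarrow> comm_subgroup G A B \<lhd> G"
  by (rule normal_comm_subgroup_gen) (simp_all add: normal_carrier normal_conj)

lemma comm_subgroup_subset:
  assumes "A \<lhd> G" "B \<lhd> G"
  shows "comm_subgroup G A B \<subseteq> A" "comm_subgroup G A B \<subseteq> B"
proof -
  have "commutator G a b \<in> A \<and> commutator G a b \<in> B" if "a \<in> A" "b \<in> B" for a b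
  proof -
    have c: "a \<in> carrier G" "b \<in> carrier G" using that assms [THEN normal_carrier] by auto
    have "inv a \<otimes> (inv b \<otimes> a \<otimes> b) \<in> A"
      using that assms [THEN normal_imp_subgroup] c
      by (intro subgroup.m_closed [of A] subgroup.m_inv_closed [of A] normal_conj assms)
    moreover have "(inv a \<otimes> inv b \<otimes> inv (inv a)) \<otimes> b \<in> B"
      using that assms [THEN normal_imp_subgroup] c
      by (intro subgroup.m_closed [of B] subgroup.m_inv_closed [of B] normal_conj assms inv_closed)
    ultimately show ?thesis using c by (simp add: group_word_simps)
  qed
  then show "comm_subgroup G A B \<subseteq> A" "comm_subgroup G A B \<subseteq> B"
    by (simp_all add: comm_subgroup_subset_iff assms normal_imp_subgroup)
qed

lemma comm_subgroup_commute:
  assumes "A \<subseteq> carrier G" "B \<subseteq> carrier G"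
  shows "comm_subgroup G A B = comm_subgroup G B A"
proof -
  have "comm_subgroup G A B \<subseteq> comm_subgroup G B A"
    if "A \<subseteq> carrier G" "B \<subseteq> carrier G" for A B
  proof -
    have sg: "subgroup (comm_subgroup G B A) G"
      unfolding comm_subgroup_def using that by (intro generate_is_subgroup comm_subgroup_carrier)
    have "commutator G a b \<in> comm_subgroup G B A" if "a \<in> A" "b \<in> B" for a b
      using commutator_in_comm_subgroup [OF that(2,1)] subgroup.m_inv_closed [OF sg] that
        inv_commutator \<open>A \<subseteq> carrier G\<close> \<open>B \<subseteq> carrier G\<close> by (metis subset_iff)
    then show ?thesis by (simp add: comm_subgroup_subset_iff sg)
  qed
  then show ?thesis using assms by blast
qed

text \<open>A normal K absorbs the conjugations that arise when [xy,z] and [x^-1,z] are expanded.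
  Later inclusions of commutator subgroups can therefore be checked on generators.\<close>

lemma comm_subgroup_generate_left:
  assumes K: "K \<lhd> G" and A: "A \<subseteq> carrier G" and B: "B \<subseteq> carrier G"
    and sub: "comm_subgroup G A B \<subseteq> K"
  shows "comm_subgroup G (generate G A) B \<subseteq> K"
proof -
  note sgK = normal_imp_subgroup [OF K]
  have base: "commutator G a b \<in> K" if "a \<in> A" "b \<in> B" for a b
    using sub that by (simp add: comm_subgroup_subset_iff [OF sgK])
  have "commutator G x b \<in> K" if "x \<in> generate G A" "b \<in> B" for x b
    using that(1)
  proof induction
    case one
    then show ?case using that(2) B subgroup.one_closed [OF sgK]
      by (auto simp: group_word_simps subset_iff)
  next
    case (incl h)
    then show ?case using base that(2) by blast
  next
    case (inv h)
    then have "h \<in> carrier G" "b \<in> carrier G" using A B that(2) by auto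
    then show ?case
      using base [OF inv that(2)] normal_conj(1) [OF K] subgroup.m_inv_closed [OF sgK]
      by (simp add: commutator_inv_left)
  next
    case (eng h1 h2)
    have "h1 \<in> carrier G" "h2 \<in> carrier G" "b \<in> carrier G"
      using A B that(2) eng(1,2) generate_in_carrier by auto
    then show ?case
      using eng(3,4) normal_conj(2) [OF K] subgroup.m_closed [OF sgK]
      by (simp add: commutator_mult_left)
  qed
  then show ?thesis by (simp add: comm_subgroup_subset_iff [OF sgK])
qed

lemma comm_subgroup_generate_right:
  assumes "K \<lhd> G" "A \<subseteq> carrier G" "B \<subseteq> carrier G" "comm_subgroup G A B \<subseteq> K"
  shows "comm_subgroup G A (generate G B) \<subseteq> K"
  using comm_subgroup_generate_left [of K B A] assms comm_subgroup_commute generate_incl by metis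

text \<open>Two of the three Hall-Witt factors lie in K by hypothesis, hence so does the
  third.\<close>

lemma three_subgroups:
  assumes "A \<lhd> G" "B \<lhd> G" "C \<lhd> G" "K \<lhd> G"
    and AC: "comm_subgroup G (comm_subgroup G A C) B \<subseteq> K"
    and BC: "comm_subgroup G (comm_subgroup G B C) A \<subseteq> K"
  shows "comm_subgroup G (comm_subgroup G A B) C \<subseteq> K"
proof -
  note sg = normal_imp_subgroup [OF \<open>A \<lhd> G\<close>] normal_imp_subgroup [OF \<open>B \<lhd> G\<close>]
    normal_imp_subgroup [OF \<open>C \<lhd> G\<close>] normal_imp_subgroup [OF \<open>K \<lhd> G\<close>]
  note car = normal_carrier [OF \<open>A \<lhd> G\<close>] normal_carrier [OF \<open>B \<lhd> G\<close>] normal_carrier [OF \<open>C \<lhd> G\<close>]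
  have CA: "comm_subgroup G (comm_subgroup G C A) B \<subseteq> K"
    using AC comm_subgroup_commute car by metis
  have "commutator G (commutator G a b) c \<in> K" if abc: "a \<in> A" "b \<in> B" "c \<in> C" for a b c
  proof -
    \<comment> \<open>The inner commutators of the Hall-Witt identity carry an inverse, so it is
      applied at b^-1 to reach [[a,b],c].\<close>
    define y where "y = inv b"
    have y: "y \<in> B" "y \<in> carrier G" "inv y = b" and ca: "a \<in> carrier G" "c \<in> carrier G"
      using abc sg car by (auto simp: y_def subgroup.m_inv_closed subset_iff)
    let ?u = "inv c \<otimes> commutator G (commutator G y (inv c)) a \<otimes> c"
    let ?v = "inv a \<otimes> commutator G (commutator G c (inv a)) y \<otimes> a"
    let ?w = "commutator G (commutator G a b) c"
    have w: "?w \<in> carrier G" "b \<in> carrier G" using abc car by (auto simp: subset_iff)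
    have "inv c \<in> C" "inv a \<in> A"
      using abc sg by (auto simp: subgroup.m_inv_closed)
    then have "commutator G (commutator G y (inv c)) a \<in> K"
      "commutator G (commutator G c (inv a)) y \<in> K"
      using BC CA abc y(1) commutator_in_comm_subgroup
      by (auto simp: comm_subgroup_subset_iff [OF sg(4)])
    then have "?u \<in> K" "?v \<in> K"
      using ca normal_conj(2) [OF \<open>K \<lhd> G\<close>] by blast+
    then have uv: "inv (?u \<otimes> ?v) \<in> K" and c: "?u \<in> carrier G" "?v \<in> carrier G"
      using sg(4) by (auto simp: subgroup.m_closed subgroup.m_inv_closed subgroup.mem_carrier)
    have "(inv y \<otimes> ?w \<otimes> y) \<otimes> ?u \<otimes> ?v = \<one>"
      using Hall_Witt [of a y c] y ca by simp
    then have "inv y \<otimes> ?w \<otimes> y = inv (?u \<otimes> ?v)"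
      using c w y by (intro inv_equality [symmetric]) (simp_all add: m_assoc)
    then have "y \<otimes> (inv y \<otimes> ?w \<otimes> y) \<otimes> inv y \<in> K"
      using uv y(2) normal_conj(1) [OF \<open>K \<lhd> G\<close>] by metis
    then show ?thesis using w y(2) unfolding y(3) [symmetric] by (simp add: m_assoc inv_mult_cancel)
  qed
  then have "comm_subgroup G {commutator G a b | a b. a \<in> A \<and> b \<in> B} C \<subseteq> K"
    by (auto simp: comm_subgroup_subset_iff [OF sg(4)])
  then show ?thesis
    unfolding comm_subgroup_def [of G A B]
    using car by (intro comm_subgroup_generate_left \<open>K \<lhd> G\<close> comm_subgroup_carrier)
qed

end

section \<open>Groups generated by finite normal sets\<close>

text \<open>The number of words of length at most \<open>q * e\<close> over an alphabet of q
  letters.\<close>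

definition collect_bound :: "nat \<Rightarrow> nat \<Rightarrow> nat" where
  "collect_bound q e = (\<Sum>i\<le>q * e. q ^ i)"

lemma collect_bound_mono: "q \<le> q' \<Longrightarrow> e \<le> e' \<Longrightarrow> collect_bound q e \<le> collect_bound q' e'"
  unfolding collect_bound_def
  by (rule order_trans [OF sum_mono sum_mono2]) (auto intro: power_mono mult_mono order_trans)

lemma collect_bound_pos: "1 \<le> collect_bound q e"
proof -
  have "q ^ 0 \<le> (\<Sum>i\<le>q * e. q ^ i)" by (rule member_le_sum) auto
  then show ?thesis by (simp add: collect_bound_def)
qed

lemma exists_frequent:
  assumes "finite Y" "set xs \<subseteq> Y" "card Y * e < length xs"
  obtains c where "c \<in> Y" "e < count_list xs c"
proof -
  have "\<not> (\<forall>c\<in>Y. count_list xs c \<le> e)"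
  proof
    assume "\<forall>c\<in>Y. count_list xs c \<le> e"
    then have "(\<Sum>c\<in>Y. count_list xs c) \<le> card Y * e"
      using sum_bounded_above [of Y "count_list xs" e] by simp
    moreover have "(\<Sum>c\<in>Y. count_list xs c) = length xs"
      using assms sum_count_set by blast
    ultimately show False using assms(3) by simp
  qed
  then show thesis using that by (meson not_le)
qed

context group
begin

section \<open>Collecting equal factors in a product\<close>

definition list_mult :: "'a list \<Rightarrow> 'a" where
  "list_mult xs = foldr (\<otimes>) xs \<one>"

lemma list_mult_simps [simp]:
  "list_mult [] = \<one>" "list_mult (x # xs) = x \<otimes> list_mult xs"
  by (simp_all add: list_mult_def)

lemma list_mult_closed [simp]: "set xs \<subseteq> carrier G \<Longrightarrow> list_mult xs \<in> carrier G"
  by (induction xs) auto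

lemma list_mult_append:
  "set xs \<subseteq> carrier G \<Longrightarrow> set ys \<subseteq> carrier G \<Longrightarrow>
   list_mult (xs @ ys) = list_mult xs \<otimes> list_mult ys"
  by (induction xs) (auto simp: m_assoc)

lemma list_mult_conj:
  assumes "set xs \<subseteq> carrier G" "c \<in> carrier G"
  shows "list_mult xs \<otimes> c = c \<otimes> list_mult (map (\<lambda>x. inv c \<otimes> x \<otimes> c) xs)"
  using assms(1)
proof (induction xs)
  case (Cons x xs)
  have "set (map (\<lambda>x. inv c \<otimes> x \<otimes> c) xs) \<subseteq> carrier G"
    using Cons.prems assms(2) by auto
  then show ?case
    using Cons assms(2) by (simp add: m_assoc inv_mult_cancel del: set_map)
qed (simp add: assms(2))

text \<open>The first copy of c is moved past the prefix before it, whose entries get conjugated by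
  c. Only c itself is conjugated to c, so the prefix still contains no copy; the count drops by
  exactly one and the move can be repeated.\<close>

lemma move_to_front:
  assumes "set xs \<subseteq> Y" "Y \<subseteq> carrier G" "c \<in> set xs"
    and conj: "\<And>x. x \<in> Y \<Longrightarrow> inv c \<otimes> x \<otimes> c \<in> Y"
  shows "\<exists>ys. set ys \<subseteq> Y \<and> length xs = Suc (length ys) \<and>
    count_list xs c = Suc (count_list ys c) \<and> list_mult xs = c \<otimes> list_mult ys"
proof -
  obtain us vs where xs: "xs = us @ c # vs" "c \<notin> set us"
    using split_list_first [OF assms(3)] by blast
  have c: "c \<in> carrier G" and car: "set us \<subseteq> carrier G" "set vs \<subseteq> carrier G"
    using assms xs by auto
  let ?us = "map (\<lambda>x. inv c \<otimes> x \<otimes> c) us"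
  have sub: "set ?us \<subseteq> Y" "set ?us \<subseteq> carrier G" using assms xs by auto
  have eq_c: "x = c" if "x \<in> carrier G" "inv c \<otimes> x \<otimes> c = c" for x
  proof -
    have "c \<otimes> (inv c \<otimes> x \<otimes> c) \<otimes> inv c = c \<otimes> c \<otimes> inv c" using that by simp
    then show ?thesis using that(1) c by (simp add: m_assoc inv_mult_cancel)
  qed
  have "c \<notin> set ?us"
  proof
    assume "c \<in> set ?us"
    then obtain x where "x \<in> set us" "inv c \<otimes> x \<otimes> c = c" by auto
    then show False using eq_c [of x] xs(2) car by auto
  qed
  then have "count_list xs c = Suc (count_list (?us @ vs) c)"
    using xs by (simp add: count_list_0_iff)
  moreover have "list_mult xs = c \<otimes> list_mult (?us @ vs)"
  proof -
    have "list_mult xs = list_mult us \<otimes> c \<otimes> list_mult vs"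
      using car c by (simp add: xs(1) list_mult_append m_assoc)
    also have "\<dots> = c \<otimes> list_mult ?us \<otimes> list_mult vs"
      using list_mult_conj [OF car(1) c] by simp
    finally show ?thesis
      using car c sub(2) by (simp add: list_mult_append m_assoc)
  qed
  moreover have "set (?us @ vs) \<subseteq> Y" using sub assms xs by auto
  moreover have "length xs = Suc (length (?us @ vs))" by (simp add: xs)
  ultimately show ?thesis by blast
qed

lemma move_power_to_front:
  assumes "set xs \<subseteq> Y" "Y \<subseteq> carrier G" "c \<in> Y" "p \<le> count_list xs c"
    and conj: "\<And>x. x \<in> Y \<Longrightarrow> inv c \<otimes> x \<otimes> c \<in> Y"
  shows "\<exists>ys. set ys \<subseteq> Y \<and> length xs = p + length ys \<and>
    list_mult xs = c [^] p \<otimes> list_mult ys"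
  using assms(1,4)
proof (induction p arbitrary: xs)
  case 0
  then have "list_mult xs \<in> carrier G" using assms(2) by (intro list_mult_closed) auto
  then show ?case using 0 by (intro exI [of _ xs]) simp
next
  case (Suc p)
  then have "c \<in> set xs" by (metis count_notin not_less_eq_eq zero_le)
  then obtain ys where ys: "set ys \<subseteq> Y" "length xs = Suc (length ys)"
      "count_list xs c = Suc (count_list ys c)" "list_mult xs = c \<otimes> list_mult ys"
    using move_to_front [OF Suc.prems(1) assms(2) _ conj] by blast
  then have "p \<le> count_list ys c" using Suc.prems(2) by simp
  then obtain zs where zs: "set zs \<subseteq> Y" "length ys = p + length zs"
      "list_mult ys = c [^] p \<otimes> list_mult zs"
    using Suc.IH [OF ys(1)] by blast
  have "c \<in> carrier G" "list_mult zs \<in> carrier G"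
    using assms zs(1) by (auto intro: list_mult_closed)
  then have "list_mult xs = c [^] Suc p \<otimes> list_mult zs"
    by (simp only: ys(4) zs(3) m_assoc nat_pow_Suc2 nat_pow_closed)
  then show ?case using ys zs by auto
qed

lemma generate_eq_list_mult:
  assumes "Y \<subseteq> carrier G" "\<And>y. y \<in> Y \<Longrightarrow> inv y \<in> Y"
  shows "generate G Y = {list_mult xs | xs. set xs \<subseteq> Y}"
proof (intro equalityI subsetI)
  fix g assume "g \<in> generate G Y"
  then show "g \<in> {list_mult xs | xs. set xs \<subseteq> Y}"
  proof induction
    case one
    then show ?case by (auto intro: exI [of _ "[]"])
  next
    case (incl h)
    then show ?case using assms(1) by (intro CollectI exI [of _ "[h]"]) auto
  next
    case (inv h)
    then show ?case using assms by (intro CollectI exI [of _ "[inv h]"]) auto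
  next
    case (eng h1 h2)
    then obtain xs ys where "h1 = list_mult xs" "set xs \<subseteq> Y" "h2 = list_mult ys" "set ys \<subseteq> Y"
      by auto
    then show ?case using assms(1)
      by (intro CollectI exI [of _ "xs @ ys"]) (auto simp: list_mult_append)
  qed
next
  fix g assume "g \<in> {list_mult xs | xs. set xs \<subseteq> Y}"
  then obtain xs where "g = list_mult xs" "set xs \<subseteq> Y" by auto
  moreover have "set xs \<subseteq> Y \<Longrightarrow> list_mult xs \<in> generate G Y"
    by (induction xs) (auto intro: generate.intros)
  ultimately show "g \<in> generate G Y" by simp
qed

text \<open>In a product of more than \<open>card Y * e\<close> factors some factor occurs at least \<open>e\<close> times; moving
  \<open>p\<close> copies of it to the front makes the product shorter.\<close>

lemma finite_generate_collect:
  assumes Y: "Y \<subseteq> carrier G" "finite Y" "\<And>y. y \<in> Y \<Longrightarrow> inv y \<in> Y"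
    and conj: "\<And>x c. x \<in> Y \<Longrightarrow> c \<in> Y \<Longrightarrow> inv c \<otimes> x \<otimes> c \<in> Y"
    and short: "\<And>c. c \<in> Y \<Longrightarrow> \<exists>p l. p \<le> e \<and> set l \<subseteq> Y \<and> length l < p \<and> c [^] p = list_mult l"
  shows "finite (generate G Y) \<and> card (generate G Y) \<le> collect_bound (card Y) e"
proof -
  have shorten: "\<exists>ys. set ys \<subseteq> Y \<and> length ys \<le> card Y * e \<and> list_mult ys = list_mult xs"
    if "set xs \<subseteq> Y" for xs
    using that
  proof (induction "length xs" arbitrary: xs rule: less_induct)
    case less
    show ?case
    proof (cases "length xs \<le> card Y * e")
      case True
      then show ?thesis using less.prems by blast
    next
      case False
      then obtain c where c: "c \<in> Y" "e < count_list xs c"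
        using exists_frequent [OF Y(2) less.prems, of e] by auto
      obtain p l where pl: "p \<le> e" "set l \<subseteq> Y" "length l < p" "c [^] p = list_mult l"
        using short [OF c(1)] by blast
      obtain ys where ys: "set ys \<subseteq> Y" "length xs = p + length ys"
          "list_mult xs = c [^] p \<otimes> list_mult ys"
        using move_power_to_front [OF less.prems Y(1) c(1), of p] pl(1) c conj by auto
      have "list_mult (l @ ys) = list_mult xs"
        using ys pl Y(1) list_mult_append [of l ys] by (metis order_trans)
      moreover have "length (l @ ys) < length xs" "set (l @ ys) \<subseteq> Y"
        using ys pl by auto
      ultimately show ?thesis using less.hyps [of "l @ ys"] by metis
    qed
  qed
  let ?L = "{xs. set xs \<subseteq> Y \<and> length xs \<le> card Y * e}"
  have sub: "generate G Y \<subseteq> list_mult ` ?L"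
  proof
    fix g assume "g \<in> generate G Y"
    then obtain xs where "g = list_mult xs" "set xs \<subseteq> Y"
      using generate_eq_list_mult [OF Y(1,3)] by auto
    then obtain ys where "ys \<in> ?L" "g = list_mult ys" using shorten [of xs] by auto
    then show "g \<in> list_mult ` ?L" by (rule rev_image_eqI)
  qed
  have fin: "finite ?L" using Y(2) by (rule finite_lists_length_le)
  have "card (generate G Y) \<le> card ?L"
    using sub fin by (meson card_image_le card_mono finite_imageI order_trans)
  also have "\<dots> = collect_bound (card Y) e"
    unfolding collect_bound_def using Y(2) by (rule card_lists_length_le)
  finally show ?thesis using sub fin finite_subset by blast
qed

text \<open>The instance of \<open>finite_generate_collect\<close> in which the shorter word for c^p
  is empty. Inverses are adjoined to S to make it closed under inversion, whence the factor 2; they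
  inherit the exponents.\<close>

lemma Dietzmann:
  assumes S: "S \<subseteq> carrier G" "finite S"
    and conj: "\<And>x z. x \<in> S \<Longrightarrow> z \<in> carrier G \<Longrightarrow> z \<otimes> x \<otimes> inv z \<in> S"
    and ord: "\<And>x. x \<in> S \<Longrightarrow> \<exists>p. 0 < p \<and> p \<le> e \<and> x [^] p = \<one>"
  shows "finite (generate G S) \<and> card (generate G S) \<le> collect_bound (2 * card S) e"
proof -
  define Y where "Y = S \<union> m_inv G ` S"
  have Y: "Y \<subseteq> carrier G" "finite Y" "\<And>y. y \<in> Y \<Longrightarrow> inv y \<in> Y"
    using S by (auto simp: Y_def)
  have conjS: "inv z \<otimes> x \<otimes> z \<in> S" if "x \<in> S" "z \<in> carrier G" for x z
    using conj [of x "inv z"] that by simp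
  have conjY: "inv c \<otimes> x \<otimes> c \<in> Y" if xc: "x \<in> Y" "c \<in> Y" for x c
  proof -
    have c: "c \<in> carrier G" using xc Y(1) by auto
    from xc(1) consider "x \<in> S" | y where "y \<in> S" "x = inv y" by (auto simp: Y_def)
    then show ?thesis
    proof cases
      case 1
      then show ?thesis using conjS c by (simp add: Y_def)
    next
      case 2
      then have "inv c \<otimes> x \<otimes> c = inv (inv c \<otimes> y \<otimes> c)"
        using c S(1) by (auto simp: inv_mult_group m_assoc subset_iff)
      then show ?thesis using conjS [OF 2(1) c] by (simp add: Y_def)
    qed
  qed
  have short: "\<exists>p l. p \<le> e \<and> set l \<subseteq> Y \<and> length l < p \<and> c [^] p = list_mult l" if "c \<in> Y" for c
  proof -
    from that consider "c \<in> S" | y where "y \<in> S" "c = inv y" by (auto simp: Y_def)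
    then have "\<exists>p. 0 < p \<and> p \<le> e \<and> c [^] p = \<one>"
    proof cases
      case 2
      then obtain p where "0 < p" "p \<le> e" "y [^] p = \<one>" using ord by blast
      then show ?thesis using 2 S(1) nat_pow_inv [of y p] by (intro exI [of _ p]) auto
    qed (rule ord)
    then obtain p where "0 < p" "p \<le> e" "c [^] p = \<one>" by blast
    then show ?thesis by (intro exI [of _ p] exI [of _ "[]"]) simp
  qed
  have "finite (generate G Y) \<and> card (generate G Y) \<le> collect_bound (card Y) e"
    using Y conjY short by (rule finite_generate_collect)
  moreover have "card Y \<le> 2 * card S"
    unfolding Y_def using card_Un_le [of S "m_inv G ` S"] card_image_le [OF S(2), of "m_inv G"] by simp
  moreover have "generate G S \<subseteq> generate G Y" by (rule mono_generate) (simp add: Y_def)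
  ultimately show ?thesis
    by (meson card_mono collect_bound_mono finite_subset order_refl order_trans)
qed

end

section \<open>Schur's theorem with an explicit bound\<close>

definition schur_bound :: "nat \<Rightarrow> nat" where
  "schur_bound m = collect_bound ((m ^ m) ^ 2) (Suc (m ^ m))"

context group
begin

lemma conj_pow:
  assumes "x \<in> carrier G" "z \<in> carrier G"
  shows "(inv z \<otimes> x \<otimes> z) [^] (n::nat) = inv z \<otimes> x [^] n \<otimes> z"
  using assms by (induction n) (auto simp: m_assoc inv_mult_cancel)

lemma commute_generate:
  assumes "A \<subseteq> carrier G" "z \<in> carrier G" "\<And>x. x \<in> A \<Longrightarrow> x \<otimes> z = z \<otimes> x" "w \<in> generate G A"
  shows "w \<otimes> z = z \<otimes> w"
  using assms(4)
proof induction
  case (inv h)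
  then have "h \<in> carrier G" "h \<otimes> z = z \<otimes> h" using assms by auto
  then show ?case
    using assms(2) by (metis inv_closed inv_solve_left inv_solve_right m_assoc m_closed)
next
  case (eng h1 h2)
  then have "h1 \<in> carrier G" "h2 \<in> carrier G"
    using generate_in_carrier assms(1) by auto
  then show ?case using eng assms(2) by (metis m_assoc)
qed (use assms in auto)

lemma commutator_mult_commute:
  assumes "a \<in> carrier G" "b \<in> carrier G" "z \<in> carrier G"
    and "a \<otimes> z = z \<otimes> a" "b \<otimes> z = z \<otimes> b"
  shows "commutator G (a \<otimes> z) b = commutator G a b" "commutator G b (a \<otimes> z) = commutator G b a"
proof -
  have "inv z \<otimes> (inv a \<otimes> (inv b \<otimes> (a \<otimes> (z \<otimes> b)))) = inv z \<otimes> inv a \<otimes> inv b \<otimes> a \<otimes> (b \<otimes> z)"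
    using assms by (simp add: m_assoc)
  also have "\<dots> = inv z \<otimes> (inv a \<otimes> (inv b \<otimes> (a \<otimes> b)) \<otimes> z)"
    using assms by (simp add: m_assoc)
  also have "inv a \<otimes> (inv b \<otimes> (a \<otimes> b)) \<otimes> z = z \<otimes> (inv a \<otimes> (inv b \<otimes> (a \<otimes> b)))"
  proof (rule commute_generate [of "{a, b}"])
    show "inv a \<otimes> (inv b \<otimes> (a \<otimes> b)) \<in> generate G {a, b}"
      by (intro generate.eng generate.inv generate.incl) auto
  qed (use assms in auto)
  finally show 1: "commutator G (a \<otimes> z) b = commutator G a b"
    using assms(1-3) by (simp add: group_word_simps)
  have "commutator G b (a \<otimes> z) = inv (commutator G (a \<otimes> z) b)"
    using assms(1-3) by (simp add: inv_commutator)
  then show "commutator G b (a \<otimes> z) = commutator G b a"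
    unfolding 1 using assms(1-3) by (simp add: inv_commutator)
qed

text \<open>Write c = [a,b] and c^(n+1) = a^-1 b^-1 a (b c^n). Moving b to the right of c^n lets one
  factor c merge with a^-1 b^-1 a into a^-1 b^-2 a b, which is [a,b^2] up to one missing b;
  inserting b b^-1 leaves the other n - 1 factors conjugated by b.\<close>

lemma commutator_pow_Suc:
  assumes ab: "a \<in> carrier G" "b \<in> carrier G" and n: "0 < n"
    and central: "b \<otimes> commutator G a b [^] (n::nat) = commutator G a b [^] n \<otimes> b"
  shows "commutator G a b [^] Suc n =
    commutator G a (b \<otimes> b) \<otimes> (inv b \<otimes> commutator G a b \<otimes> b) [^] (n - 1)"
proof -
  let ?c = "commutator G a b"
  obtain k where k: "n = Suc k" using n gr0_implies_Suc by blast
  have c: "?c \<in> carrier G" "?c [^] n \<in> carrier G" "?c [^] k \<in> carrier G" using ab by auto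
  have "?c [^] Suc n = ?c \<otimes> ?c [^] n"
    using c by (simp only: nat_pow_Suc2)
  also have "\<dots> = inv a \<otimes> inv b \<otimes> a \<otimes> (b \<otimes> ?c [^] n)"
    using ab c by (simp add: commutator_def [of G a b] m_assoc)
  also have "\<dots> = inv a \<otimes> inv b \<otimes> a \<otimes> (?c \<otimes> ?c [^] k \<otimes> b)"
    unfolding central using c by (simp only: k nat_pow_Suc2)
  also have "\<dots> = inv a \<otimes> inv b \<otimes> a \<otimes> (inv a \<otimes> inv b \<otimes> a \<otimes> b) \<otimes> (?c [^] k \<otimes> b)"
    using ab c by (simp add: commutator_def [of G a b] m_assoc)
  also have "\<dots> = commutator G a (b \<otimes> b) \<otimes> (inv b \<otimes> ?c [^] k \<otimes> b)"
    using ab c(3) by (simp add: commutator_def [of G a "b \<otimes> b"] m_assoc inv_mult_group inv_mult_cancel)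
  finally show ?thesis using ab c by (simp add: k conj_pow)
qed

text \<open>A form of Schur's theorem: the elements of \<open>W = \<langle>S\<rangle>\<close> fall into at most \<open>m ^ m\<close> classes modulo
  the centre of \<open>W\<close>, so there are at most \<open>(m ^ m) ^ 2\<close> commutators, and \<open>[a, b] ^ (n + 1)\<close> is a
  product of \<open>n\<close> commutators whenever \<open>[a, b] ^ n\<close> is central.\<close>

lemma finite_derived_generate:
  assumes S: "S \<subseteq> carrier G" "finite S" "card S = m"
    and conj: "\<And>x z. x \<in> S \<Longrightarrow> z \<in> carrier G \<Longrightarrow> z \<otimes> x \<otimes> inv z \<in> S"
  defines "W \<equiv> generate G S"
  shows "finite (comm_subgroup G W W) \<and> card (comm_subgroup G W W) \<le> schur_bound m"
proof -
  have nW: "W \<lhd> G" unfolding W_def using S(1) conj by (rule normal_generate)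
  note sgW = normal_imp_subgroup [OF nW]
  have W: "W \<subseteq> carrier G" using nW by (rule normal_carrier)
  \<comment> \<open>The conjugation action on S, as one of at most m ^ m functions. Elements with
    the same action differ by a factor that centralizes W.\<close>
  define act where "act z = (\<lambda>x\<in>S. z \<otimes> x \<otimes> inv z)" for z
  have act: "act z \<in> S \<rightarrow>\<^sub>E S" if "z \<in> carrier G" for z
    using conj that by (auto simp: act_def)
  have fin: "finite (S \<rightarrow>\<^sub>E S)" and card_fun: "card (S \<rightarrow>\<^sub>E S) = m ^ m"
    using S(2,3) by (auto simp: finite_PiE card_funcsetE)
  have act_eq: "w \<otimes> (inv z \<otimes> z') = (inv z \<otimes> z') \<otimes> w"
    if "z \<in> carrier G" "z' \<in> carrier G" "act z = act z'" "w \<in> W" for z z' w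
  proof (rule commute_generate [OF S(1)])
    show "w \<in> generate G S" using that by (simp add: W_def)
    fix x assume x: "x \<in> S"
    then have xc: "x \<in> carrier G" using S by auto
    have "z \<otimes> x \<otimes> inv z = z' \<otimes> x \<otimes> inv z'"
      using that(3) x by (metis act_def restrict_apply')
    then have "inv z \<otimes> (z \<otimes> x \<otimes> inv z) \<otimes> z' = inv z \<otimes> (z' \<otimes> x \<otimes> inv z') \<otimes> z'" by simp
    then show "x \<otimes> (inv z \<otimes> z') = inv z \<otimes> z' \<otimes> x"
      using that(1,2) xc by (simp add: m_assoc inv_mult_cancel)
  qed (use that in simp)
  define Y where "Y = {commutator G a b | a b. a \<in> W \<and> b \<in> W}"
  have comm_eq: "commutator G a b = commutator G a' b'"
    if "a \<in> W" "b \<in> W" "a' \<in> W" "b' \<in> W" "act a = act a'" "act b = act b'" for a b a' b'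
  proof -
    have c: "a \<in> carrier G" "b \<in> carrier G" "a' \<in> carrier G" "b' \<in> carrier G"
      using that W by auto
    have "commutator G (a \<otimes> (inv a \<otimes> a')) b = commutator G a b"
      using c act_eq [OF c(1,3) that(5)] that(1,2) by (intro commutator_mult_commute(1)) auto
    moreover have "commutator G a' (b \<otimes> (inv b \<otimes> b')) = commutator G a' b"
      using c act_eq [OF c(2,4) that(6)] that(2,3) by (intro commutator_mult_commute(2)) auto
    ultimately show ?thesis using c by (simp add: inv_mult_cancel)
  qed
  \<comment> \<open>One element of W is fixed for each action that occurs; every commutator of W is
    then a commutator of two such representatives.\<close>
  define rep where "rep u = (SOME z. z \<in> W \<and> act z = u)" for u
  have rep: "rep (act z) \<in> W \<and> act (rep (act z)) = act z" if "z \<in> W" for z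
    unfolding rep_def by (rule someI [of _ z]) (simp add: that)
  let ?f = "\<lambda>(u, v). commutator G (rep u) (rep v)"
  have Ysub: "Y \<subseteq> ?f ` ((S \<rightarrow>\<^sub>E S) \<times> (S \<rightarrow>\<^sub>E S))"
  proof
    fix y assume "y \<in> Y"
    then obtain a b where ab: "a \<in> W" "b \<in> W" "y = commutator G a b" by (auto simp: Y_def)
    have "y = ?f (act a, act b)"
      using comm_eq [of a b "rep (act a)" "rep (act b)"] rep ab by simp
    moreover have "(act a, act b) \<in> (S \<rightarrow>\<^sub>E S) \<times> (S \<rightarrow>\<^sub>E S)" using act ab W by auto
    ultimately show "y \<in> ?f ` ((S \<rightarrow>\<^sub>E S) \<times> (S \<rightarrow>\<^sub>E S))" by (rule image_eqI)
  qed
  have finY: "finite Y" using Ysub fin by (meson finite_SigmaI finite_imageI finite_subset)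
  have "card Y \<le> card ((S \<rightarrow>\<^sub>E S) \<times> (S \<rightarrow>\<^sub>E S))"
    using Ysub fin by (meson card_image_le card_mono finite_SigmaI finite_imageI order_trans)
  then have cardY: "card Y \<le> (m ^ m) ^ 2"
    by (simp add: card_cartesian_product card_fun power2_eq_square)
  have YW: "Y \<subseteq> W" using comm_subgroup_subset(1) [OF nW nW] commutator_in_comm_subgroup
    unfolding Y_def by blast
  have Yc: "Y \<subseteq> carrier G" using YW W by blast
  have Yinv: "inv y \<in> Y" if "y \<in> Y" for y
    using that W unfolding Y_def by (force simp: inv_commutator subset_iff)
  have Yconj: "inv z \<otimes> y \<otimes> z \<in> Y" if y: "y \<in> Y" and z: "z \<in> carrier G" for y z
  proof -
    obtain a b where ab: "y = commutator G a b" "a \<in> W" "b \<in> W" using y by (auto simp: Y_def)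
    have c: "a \<in> carrier G" "b \<in> carrier G" using ab W by auto
    have "inv z \<otimes> y \<otimes> z = commutator G (inv z \<otimes> a \<otimes> z) (inv z \<otimes> b \<otimes> z)"
      using commutator_conj [OF c, of "inv z"] z ab(1) by simp
    then show ?thesis
      unfolding Y_def using normal_conj(2) [OF nW ab(2) z] normal_conj(2) [OF nW ab(3) z]
      by (intro CollectI exI conjI)
  qed
  have short: "\<exists>p l. p \<le> Suc (m ^ m) \<and> set l \<subseteq> Y \<and> length l < p \<and> c [^] p = list_mult l"
    if cY: "c \<in> Y" for c
  proof -
    obtain a b where ab: "c = commutator G a b" "a \<in> W" "b \<in> W" using cY by (auto simp: Y_def)
    have cc: "a \<in> carrier G" "b \<in> carrier G" "c \<in> carrier G"
      using ab(2,3) W cY Yc by auto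
    \<comment> \<open>The m ^ m + 1 powers c^0, ..., c^(m^m) have at most m ^ m actions, so some c^n
      with 0 < n \<le> m ^ m centralizes W.\<close>
    have "\<not> inj_on (\<lambda>i::nat. act (c [^] i)) {..m ^ m}"
    proof
      assume "inj_on (\<lambda>i::nat. act (c [^] i)) {..m ^ m}"
      then have "card {..m ^ m} \<le> card (S \<rightarrow>\<^sub>E S)"
        using act cc fin by (intro card_inj_on_le [of "\<lambda>i. act (c [^] i)"]) auto
      then show False by (simp add: card_fun)
    qed
    then obtain i j :: nat where ij: "i < j" "j \<le> m ^ m" "act (c [^] i) = act (c [^] j)"
      unfolding inj_on_def by (metis atMost_iff linorder_neqE_nat)
    define n where "n = j - i"
    have n: "0 < n" "n \<le> m ^ m" "j = i + n" using ij by (auto simp: n_def)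
    have "inv (c [^] i) \<otimes> c [^] j = c [^] n"
      using cc by (simp add: n(3) nat_pow_mult [symmetric] inv_mult_cancel)
    then have "b \<otimes> c [^] n = c [^] n \<otimes> b"
      using act_eq [of "c [^] i" "c [^] j" b] ij(3) cc ab(3) by simp
    then have eq: "c [^] Suc n = commutator G a (b \<otimes> b) \<otimes> (inv b \<otimes> c \<otimes> b) [^] (n - 1)"
      using commutator_pow_Suc [OF cc(1,2) n(1)] ab(1) by simp
    \<comment> \<open>A word of length n for c^(n+1), shorter by one as the collection argument
      demands.\<close>
    let ?l = "commutator G a (b \<otimes> b) # replicate (n - 1) (inv b \<otimes> c \<otimes> b)"
    have mult_rep: "list_mult (replicate k x) = x [^] k" if "x \<in> carrier G" for k :: nat and x
    proof (induction k)
      case (Suc k)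
      then show ?case by (simp only: replicate_Suc list_mult_simps nat_pow_Suc2 [OF that])
    qed simp
    have "c [^] Suc n = list_mult ?l" using eq cc by (simp add: mult_rep)
    moreover have "commutator G a (b \<otimes> b) \<in> Y"
      unfolding Y_def using ab subgroup.m_closed [OF sgW] by blast
    then have "set ?l \<subseteq> Y" using Yconj [OF cY cc(2)] by (auto simp: in_set_replicate)
    moreover have "length ?l < Suc n" using n by simp
    ultimately show ?thesis using n(2) by (intro exI [of _ "Suc n"] exI [of _ ?l]) auto
  qed
  have "finite (generate G Y) \<and> card (generate G Y) \<le> collect_bound (card Y) (Suc (m ^ m))"
    using Yc finY Yinv _ short
  proof (rule finite_generate_collect)
    show "inv c \<otimes> x \<otimes> c \<in> Y" if "x \<in> Y" "c \<in> Y" for x c using Yconj that Yc by auto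
  qed auto
  then show ?thesis
    unfolding comm_subgroup_def Y_def [symmetric] schur_bound_def
    using collect_bound_mono [OF cardY order_refl] order_trans by blast
qed

end

section \<open>Derived words on tuples of normal subgroups\<close>

abbreviation delta_values :: "('a, 'b) monoid_scheme \<Rightarrow> nat \<Rightarrow> (nat \<Rightarrow> 'a set) \<Rightarrow> 'a set" where
  "delta_values G k N \<equiv> word_values G (delta_word k) (2 ^ k) N"

abbreviation delta_subgroup :: "('a, 'b) monoid_scheme \<Rightarrow> nat \<Rightarrow> (nat \<Rightarrow> 'a set) \<Rightarrow> 'a set" where
  "delta_subgroup G k N \<equiv> word_subgroup G (delta_word k) (2 ^ k) N"

abbreviation shift :: "nat \<Rightarrow> (nat \<Rightarrow> 'c) \<Rightarrow> nat \<Rightarrow> 'c" where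
  "shift k N \<equiv> \<lambda>i. N (2 ^ k + i)"

definition normal_tuple :: "('a, 'b) monoid_scheme \<Rightarrow> nat \<Rightarrow> (nat \<Rightarrow> 'a set) \<Rightarrow> bool" where
  "normal_tuple G k N \<longleftrightarrow> (\<forall>i\<in>{1..2 ^ k}. N i \<lhd> G)"

text \<open>The common shape of the error terms: a product of subgroups in each of which a single
  entry of N is replaced. It is used with Y p = [N p, Z], for commutators with Z, and with Y p
  containing N p \<inter> A at the entries that do not contain A.\<close>

definition refined_subgroup ::
    "('a, 'b) monoid_scheme \<Rightarrow> nat \<Rightarrow> (nat \<Rightarrow> 'a set) \<Rightarrow> (nat \<Rightarrow> 'a set) \<Rightarrow> 'a set" where
  "refined_subgroup G k N Y = generate G (\<Union>p\<in>{1..2 ^ k}. delta_subgroup G k (N(p := Y p)))"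

primrec derived_term :: "('a, 'b) monoid_scheme \<Rightarrow> 'a set \<Rightarrow> nat \<Rightarrow> 'a set" where
  "derived_term G A 0 = A"
| "derived_term G A (Suc t) = comm_subgroup G (derived_term G A t) (derived_term G A t)"

lemma index_Suc_iff:
  "i \<in> {1..2 ^ Suc k} \<longleftrightarrow> i \<in> {1..2 ^ k} \<or> (\<exists>j\<in>{1..2 ^ k}. i = 2 ^ k + j)" for i k :: nat
proof
  assume "i \<in> {1..2 ^ Suc k}"
  then show "i \<in> {1..2 ^ k} \<or> (\<exists>j\<in>{1..2 ^ k}. i = 2 ^ k + j)"
  proof (cases "i \<le> 2 ^ k")
    case False
    with \<open>i \<in> {1..2 ^ Suc k}\<close> have "i - 2 ^ k \<in> {1..2 ^ k}" "i = 2 ^ k + (i - 2 ^ k)" by auto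
    then show ?thesis by blast
  qed simp
qed auto

lemma ball_index_Suc_iff:
  "(\<forall>i\<in>{1..2 ^ Suc k}. P i) \<longleftrightarrow> (\<forall>i\<in>{1..2 ^ k}. P i) \<and> (\<forall>i\<in>{1..2 ^ k}. P (2 ^ k + i))"
  for P :: "nat \<Rightarrow> bool"
  unfolding Ball_def index_Suc_iff by blast

lemma bex_index_Suc_iff:
  "(\<exists>i\<in>{1..2 ^ Suc k}. P i) \<longleftrightarrow> (\<exists>i\<in>{1..2 ^ k}. P i) \<or> (\<exists>i\<in>{1..2 ^ k}. P (2 ^ k + i))"
  for P :: "nat \<Rightarrow> bool"
  using ball_index_Suc_iff [of k "\<lambda>i. \<not> P i"] by blast

lemma normal_tuple_Suc:
  "normal_tuple G (Suc k) N \<longleftrightarrow> normal_tuple G k N \<and> normal_tuple G k (shift k N)"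
  unfolding normal_tuple_def by (rule ball_index_Suc_iff)

lemma normal_tuple_update: "normal_tuple G k N \<Longrightarrow> Z \<lhd> G \<Longrightarrow> normal_tuple G k (N(p := Z))"
  by (simp add: normal_tuple_def)

lemma geval_map_gword: "geval G g (map_gword f w) = geval G (\<lambda>i. g (f i)) w"
  by (induction w) auto

lemma geval_cong: "(\<And>i. i \<in> set_gword w \<Longrightarrow> g i = h i) \<Longrightarrow> geval G g w = geval G h w"
  by (induction w) auto

lemma set_delta_word: "set_gword (delta_word k) \<subseteq> {1..2 ^ k}"
proof (induction k)
  case (Suc k)
  then show ?case by (fastforce simp: gcomm_def gword.set_map)
qed simp

lemma geval_delta_cong:
  assumes "\<And>i. i \<in> {1..2 ^ k} \<Longrightarrow> g i = h i"
  shows "geval G g (delta_word k) = geval G h (delta_word k)"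
  using assms set_delta_word [of k] by (intro geval_cong) blast

lemma geval_delta_Suc:
  "geval G g (delta_word (Suc k)) =
   commutator G (geval G g (delta_word k)) (geval G (shift k g) (delta_word k))"
  by (simp add: gcomm_def commutator_def geval_map_gword)

lemma delta_values_0: "delta_values G 0 N = N 1"
proof -
  have "x \<in> delta_values G 0 N" if "x \<in> N 1" for x
    unfolding word_values_def using that by (intro CollectI exI [of _ "\<lambda>_. x"]) simp
  then show ?thesis by (auto simp: word_values_def)
qed

lemma delta_values_Suc:
  "delta_values G (Suc k) N =
   {commutator G a b | a b. a \<in> delta_values G k N \<and> b \<in> delta_values G k (shift k N)}"
proof (intro equalityI subsetI)
  fix x assume "x \<in> delta_values G (Suc k) N"
  then obtain g where g: "x = geval G g (delta_word (Suc k))" "\<forall>i\<in>{1..2 ^ Suc k}. g i \<in> N i"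
    unfolding word_values_def by blast
  note g2 = g(2) [unfolded ball_index_Suc_iff]
  have "geval G g (delta_word k) \<in> delta_values G k N"
    "geval G (shift k g) (delta_word k) \<in> delta_values G k (shift k N)"
    unfolding word_values_def using g2 by blast+
  then show "x \<in> {commutator G a b | a b. a \<in> delta_values G k N \<and> b \<in> delta_values G k (shift k N)}"
    unfolding g(1) geval_delta_Suc by blast
next
  fix x assume "x \<in> {commutator G a b | a b. a \<in> delta_values G k N \<and> b \<in> delta_values G k (shift k N)}"
  then obtain g h where x: "x = commutator G (geval G g (delta_word k)) (geval G h (delta_word k))"
    and g: "\<forall>i\<in>{1..2 ^ k}. g i \<in> N i" and h: "\<forall>i\<in>{1..2 ^ k}. h i \<in> N (2 ^ k + i)"
    unfolding word_values_def by blast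
  define f where "f i = (if i \<le> 2 ^ k then g i else h (i - 2 ^ k))" for i
  have "geval G f (delta_word k) = geval G g (delta_word k)"
    by (rule geval_delta_cong) (simp add: f_def)
  moreover have "geval G (shift k f) (delta_word k) = geval G h (delta_word k)"
    by (rule geval_delta_cong) (simp add: f_def)
  ultimately have "x = geval G f (delta_word (Suc k))" by (simp only: x geval_delta_Suc)
  moreover have "\<forall>i\<in>{1..2 ^ Suc k}. f i \<in> N i"
    unfolding ball_index_Suc_iff using g h by (auto simp: f_def)
  ultimately show "x \<in> delta_values G (Suc k) N" unfolding word_values_def by blast
qed

lemma delta_values_mono:
  "(\<And>i. i \<in> {1..2 ^ k} \<Longrightarrow> M i \<subseteq> N i) \<Longrightarrow> delta_values G k M \<subseteq> delta_values G k N"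
  unfolding word_values_def by blast

context group
begin

lemma delta_subgroup_mono:
  "(\<And>i. i \<in> {1..2 ^ k} \<Longrightarrow> M i \<subseteq> N i) \<Longrightarrow> delta_subgroup G k M \<subseteq> delta_subgroup G k N"
  unfolding word_subgroup_def by (intro mono_generate delta_values_mono)

lemma delta_subgroup_cong:
  "(\<And>i. i \<in> {1..2 ^ k} \<Longrightarrow> M i = N i) \<Longrightarrow> delta_subgroup G k M = delta_subgroup G k N"
  by (intro equalityI delta_subgroup_mono) auto

lemma delta_values_conj:
  assumes "normal_tuple G k N"
  shows "delta_values G k N \<subseteq> carrier G"
    and "\<And>x z. x \<in> delta_values G k N \<Longrightarrow> z \<in> carrier G \<Longrightarrow> z \<otimes> x \<otimes> inv z \<in> delta_values G k N"
proof -
  have "delta_values G k N \<subseteq> carrier G \<and>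
    (\<forall>x\<in>delta_values G k N. \<forall>z\<in>carrier G. z \<otimes> x \<otimes> inv z \<in> delta_values G k N)"
    using assms
  proof (induction k arbitrary: N)
    case 0
    then have "N 1 \<lhd> G" by (simp add: normal_tuple_def)
    then show ?case unfolding delta_values_0 using normal_carrier normal_conj(1) by blast
  next
    case (Suc k)
    let ?A = "delta_values G k N" and ?B = "delta_values G k (shift k N)"
    have A: "?A \<subseteq> carrier G" "\<forall>x\<in>?A. \<forall>z\<in>carrier G. z \<otimes> x \<otimes> inv z \<in> ?A"
      using Suc.IH [of N] Suc.prems by (simp_all add: normal_tuple_Suc)
    have B: "?B \<subseteq> carrier G" "\<forall>x\<in>?B. \<forall>z\<in>carrier G. z \<otimes> x \<otimes> inv z \<in> ?B"
      using Suc.IH [of "shift k N"] Suc.prems by (simp_all add: normal_tuple_Suc)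
    have "z \<otimes> commutator G a b \<otimes> inv z \<in> delta_values G (Suc k) N"
      if "a \<in> ?A" "b \<in> ?B" "z \<in> carrier G" for a b z
    proof -
      have "z \<otimes> commutator G a b \<otimes> inv z = commutator G (z \<otimes> a \<otimes> inv z) (z \<otimes> b \<otimes> inv z)"
        using that A(1) B(1) by (simp add: commutator_conj subset_iff)
      then show ?thesis unfolding delta_values_Suc using that A(2) B(2) by blast
    qed
    moreover have "delta_values G (Suc k) N \<subseteq> carrier G"
      unfolding delta_values_Suc using A(1) B(1) by (rule comm_subgroup_carrier)
    ultimately show ?case unfolding delta_values_Suc [of G k N] by blast
  qed
  then show "delta_values G k N \<subseteq> carrier G"
    and "\<And>x z. x \<in> delta_values G k N \<Longrightarrow> z \<in> carrier G \<Longrightarrow> z \<otimes> x \<otimes> inv z \<in> delta_values G k N"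
    by blast+
qed

lemma normal_delta_subgroup: "normal_tuple G k N \<Longrightarrow> delta_subgroup G k N \<lhd> G"
  unfolding word_subgroup_def by (intro normal_generate delta_values_conj)

lemma delta_values_subset_subgroup: "delta_values G k N \<subseteq> delta_subgroup G k N"
  unfolding word_subgroup_def by (auto intro: generate.incl)

lemma delta_subgroup_0: "N 1 \<lhd> G \<Longrightarrow> delta_subgroup G 0 N = N 1"
  unfolding word_subgroup_def delta_values_0
  by (intro generateI [symmetric] normal_imp_subgroup) auto

text \<open>Both sets of values are closed under conjugation, so commutators of values generate a
  normal subgroup, and the inclusion passes from values to the subgroups they generate. From here
  on, induction on k can work with subgroups instead of values.\<close>

lemma delta_subgroup_Suc:
  assumes "normal_tuple G (Suc k) N"
  shows "delta_subgroup G (Suc k) N =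
    comm_subgroup G (delta_subgroup G k N) (delta_subgroup G k (shift k N))"
proof -
  let ?A = "delta_values G k N" and ?B = "delta_values G k (shift k N)"
  have nt: "normal_tuple G k N" "normal_tuple G k (shift k N)"
    using assms by (simp_all add: normal_tuple_Suc)
  note A = delta_values_conj [OF nt(1)] and B = delta_values_conj [OF nt(2)]
  have eq: "delta_subgroup G (Suc k) N = comm_subgroup G ?A ?B"
    by (simp only: word_subgroup_def delta_values_Suc comm_subgroup_def)
  have n: "comm_subgroup G ?A ?B \<lhd> G"
    using A B by (intro normal_comm_subgroup_gen)
  have "comm_subgroup G (generate G ?A) ?B \<subseteq> comm_subgroup G ?A ?B"
    using n A(1) B(1) order_refl by (rule comm_subgroup_generate_left)
  then have "comm_subgroup G (generate G ?A) (generate G ?B) \<subseteq> comm_subgroup G ?A ?B"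
    using n B(1) generate_incl [OF A(1)] by (intro comm_subgroup_generate_right)
  moreover have "comm_subgroup G ?A ?B \<subseteq> comm_subgroup G (generate G ?A) (generate G ?B)"
    by (intro comm_subgroup_mono subsetI generate.incl)
  ultimately show ?thesis unfolding eq by (simp add: word_subgroup_def)
qed

lemma delta_subgroup_update_left:
  assumes "normal_tuple G (Suc k) N" "Z \<lhd> G" "p \<in> {1..2 ^ k}"
  shows "delta_subgroup G (Suc k) (N(p := Z)) =
    comm_subgroup G (delta_subgroup G k (N(p := Z))) (delta_subgroup G k (shift k N))"
proof -
  have "delta_subgroup G k (shift k (N(p := Z))) = delta_subgroup G k (shift k N)"
    using assms(3) by (intro delta_subgroup_cong) auto
  then show ?thesis
    using delta_subgroup_Suc [OF normal_tuple_update [OF assms(1,2)]] by simp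
qed

lemma delta_subgroup_update_right:
  assumes "normal_tuple G (Suc k) N" "Z \<lhd> G" "p \<in> {1..2 ^ k}"
  shows "delta_subgroup G (Suc k) (N(2 ^ k + p := Z)) =
    comm_subgroup G (delta_subgroup G k N) (delta_subgroup G k ((shift k N)(p := Z)))"
proof -
  have "delta_subgroup G k (N(2 ^ k + p := Z)) = delta_subgroup G k N"
    using assms(3) by (intro delta_subgroup_cong) auto
  moreover have "shift k (N(2 ^ k + p := Z)) = (shift k N)(p := Z)"
    by (auto simp: fun_eq_iff)
  ultimately show ?thesis
    using delta_subgroup_Suc [OF normal_tuple_update [OF assms(1,2)]] by simp
qed

lemma delta_subgroup_subset:
  "normal_tuple G k N \<Longrightarrow> i \<in> {1..2 ^ k} \<Longrightarrow> delta_subgroup G k N \<subseteq> N i"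
proof (induction k arbitrary: N i)
  case 0
  then show ?case using delta_subgroup_0 [of N] by (simp add: normal_tuple_def)
next
  case (Suc k)
  have nt: "normal_tuple G k N" "normal_tuple G k (shift k N)"
    using Suc.prems(1) by (simp_all add: normal_tuple_Suc)
  note sub = comm_subgroup_subset [OF nt [THEN normal_delta_subgroup]]
  from Suc.prems(2) show ?case
    unfolding index_Suc_iff delta_subgroup_Suc [OF Suc.prems(1)]
    using sub Suc.IH [OF nt(1)] Suc.IH [OF nt(2)] by blast
qed

section \<open>Error terms with one replaced entry\<close>

lemma normal_refined_subgroup:
  assumes "normal_tuple G k N" "normal_tuple G k Y"
  shows "refined_subgroup G k N Y \<lhd> G"
  unfolding refined_subgroup_def
proof (rule normal_generate)
  have n: "delta_subgroup G k (N(p := Y p)) \<lhd> G" if "p \<in> {1..2 ^ k}" for p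
    using assms that by (intro normal_delta_subgroup normal_tuple_update) (auto simp: normal_tuple_def)
  then show "(\<Union>p\<in>{1..2 ^ k}. delta_subgroup G k (N(p := Y p))) \<subseteq> carrier G"
    by (intro UN_least normal_carrier)
  show "z \<otimes> x \<otimes> inv z \<in> (\<Union>p\<in>{1..2 ^ k}. delta_subgroup G k (N(p := Y p)))"
    if x: "x \<in> (\<Union>p\<in>{1..2 ^ k}. delta_subgroup G k (N(p := Y p)))" and z: "z \<in> carrier G" for x z
  proof -
    obtain p where p: "p \<in> {1..2 ^ k}" "x \<in> delta_subgroup G k (N(p := Y p))" using x by blast
    show ?thesis using normal_conj(1) [OF n [OF p(1)] p(2) z] p(1) by (rule UN_I [rotated])
  qed
qed

lemma delta_subgroup_update_subset:
  "p \<in> {1..2 ^ k} \<Longrightarrow> delta_subgroup G k (N(p := Y p)) \<subseteq> refined_subgroup G k N Y"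
  unfolding refined_subgroup_def by (intro subsetI generate.incl UN_I)

lemma refined_subgroup_subset:
  assumes "subgroup K G" "\<And>p. p \<in> {1..2 ^ k} \<Longrightarrow> delta_subgroup G k (N(p := Y p)) \<subseteq> K"
  shows "refined_subgroup G k N Y \<subseteq> K"
  unfolding refined_subgroup_def using assms by (intro generate_subgroup_incl UN_least)

text \<open>An error term of the left half remains an error term, with the same replaced entry, once
  the right half is attached. This drives the inductions on k below.\<close>

lemma comm_refined_left:
  assumes N: "normal_tuple G (Suc k) N" and Y: "normal_tuple G (Suc k) Y"
  shows "comm_subgroup G (refined_subgroup G k N Y) (delta_subgroup G k (shift k N))
    \<subseteq> refined_subgroup G (Suc k) N Y"
proof -
  let ?K = "refined_subgroup G (Suc k) N Y" and ?B = "delta_subgroup G k (shift k N)"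
  have K: "?K \<lhd> G" using N Y by (rule normal_refined_subgroup)
  have nt: "normal_tuple G k N" "normal_tuple G k (shift k N)"
    using N by (simp_all add: normal_tuple_Suc)
  have nY: "Y p \<lhd> G" if "p \<in> {1..2 ^ k}" for p
    using Y that by (simp add: normal_tuple_Suc normal_tuple_def)
  show ?thesis
    unfolding refined_subgroup_def [of G k]
  proof (rule comm_subgroup_generate_left [OF K])
    show "(\<Union>p\<in>{1..2 ^ k}. delta_subgroup G k (N(p := Y p))) \<subseteq> carrier G"
      using nt(1) nY by (intro UN_least normal_carrier normal_delta_subgroup normal_tuple_update)
    show "?B \<subseteq> carrier G" using nt(2) by (intro normal_carrier normal_delta_subgroup)
    have "commutator G a b \<in> ?K"
      if p: "p \<in> {1..2 ^ k}" and "a \<in> delta_subgroup G k (N(p := Y p))" "b \<in> ?B" for a b p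
    proof -
      have "commutator G a b \<in> delta_subgroup G (Suc k) (N(p := Y p))"
        unfolding delta_subgroup_update_left [OF N nY [OF p] p]
        using that(2,3) by (rule commutator_in_comm_subgroup)
      then show ?thesis
        using delta_subgroup_update_subset [of p "Suc k" N Y] p by auto
    qed
    then show "comm_subgroup G (\<Union>p\<in>{1..2 ^ k}. delta_subgroup G k (N(p := Y p))) ?B \<subseteq> ?K"
      unfolding comm_subgroup_subset_iff [OF normal_imp_subgroup [OF K]] by blast
  qed
qed

lemma comm_refined_right:
  assumes N: "normal_tuple G (Suc k) N" and Y: "normal_tuple G (Suc k) Y"
  shows "comm_subgroup G (delta_subgroup G k N) (refined_subgroup G k (shift k N) (shift k Y))
    \<subseteq> refined_subgroup G (Suc k) N Y"
proof -
  let ?K = "refined_subgroup G (Suc k) N Y" and ?A = "delta_subgroup G k N"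
  have K: "?K \<lhd> G" using N Y by (rule normal_refined_subgroup)
  have nt: "normal_tuple G k N" "normal_tuple G k (shift k N)"
    using N by (simp_all add: normal_tuple_Suc)
  have nY: "Y (2 ^ k + p) \<lhd> G" if "p \<in> {1..2 ^ k}" for p
    using Y that by (simp add: normal_tuple_Suc normal_tuple_def)
  let ?U = "\<Union>p\<in>{1..2 ^ k}. delta_subgroup G k ((shift k N)(p := Y (2 ^ k + p)))"
  show ?thesis
    unfolding refined_subgroup_def [of G k]
  proof (rule comm_subgroup_generate_right [OF K])
    show "?U \<subseteq> carrier G"
      using nt(2) nY by (intro UN_least normal_carrier normal_delta_subgroup normal_tuple_update)
    show "?A \<subseteq> carrier G" using nt(1) by (intro normal_carrier normal_delta_subgroup)
    have "commutator G a b \<in> ?K"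
      if p: "p \<in> {1..2 ^ k}" and "a \<in> ?A" "b \<in> delta_subgroup G k ((shift k N)(p := Y (2 ^ k + p)))"
      for a b p
    proof -
      have "commutator G a b \<in> delta_subgroup G (Suc k) (N(2 ^ k + p := Y (2 ^ k + p)))"
        unfolding delta_subgroup_update_right [OF N nY [OF p] p]
        using that(2,3) by (rule commutator_in_comm_subgroup)
      then show ?thesis
        using delta_subgroup_update_subset [of "2 ^ k + p" "Suc k" N Y] p by auto
    qed
    then show "comm_subgroup G ?A ?U \<subseteq> ?K"
      unfolding comm_subgroup_subset_iff [OF normal_imp_subgroup [OF K]] by blast
  qed
qed

lemma normal_tuple_comm:
  "normal_tuple G k N \<Longrightarrow> Z \<lhd> G \<Longrightarrow> normal_tuple G k (\<lambda>p. comm_subgroup G (N p) Z)"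
  by (simp add: normal_tuple_def normal_comm_subgroup)

text \<open>Commutation with Z behaves like a derivation: the three subgroups lemma bounds [[A,B],Z]
  by [[A,Z],B] and [[B,Z],A], and so pushes Z down to single entries.\<close>

lemma comm_delta_subgroup:
  assumes "normal_tuple G k N" "Z \<lhd> G"
  shows "comm_subgroup G (delta_subgroup G k N) Z
    \<subseteq> refined_subgroup G k N (\<lambda>p. comm_subgroup G (N p) Z)"
  using assms(1)
proof (induction k arbitrary: N)
  case 0
  then have N1: "N 1 \<lhd> G" by (simp add: normal_tuple_def)
  have "delta_subgroup G 0 (N(1 := comm_subgroup G (N 1) Z)) = comm_subgroup G (N 1) Z"
    using delta_subgroup_0 [of "N(1 := comm_subgroup G (N 1) Z)"]
      normal_comm_subgroup [OF N1 assms(2)] by simp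
  then show ?case
    using delta_subgroup_update_subset [of 1 0 N "\<lambda>p. comm_subgroup G (N p) Z"] delta_subgroup_0 [of N, OF N1]
    by simp
next
  case (Suc k)
  let ?Y = "\<lambda>p. comm_subgroup G (N p) Z"
  let ?K = "refined_subgroup G (Suc k) N ?Y"
  let ?A = "delta_subgroup G k N" and ?B = "delta_subgroup G k (shift k N)"
  have Y: "normal_tuple G (Suc k) ?Y" using Suc.prems assms(2) by (rule normal_tuple_comm)
  have nt: "normal_tuple G k N" "normal_tuple G k (shift k N)"
    using Suc.prems by (simp_all add: normal_tuple_Suc)
  note n = nt [THEN normal_delta_subgroup]
  have 1: "comm_subgroup G (comm_subgroup G ?A Z) ?B \<subseteq> ?K"
    using comm_subgroup_mono [OF Suc.IH [OF nt(1)] order_refl] comm_refined_left [OF Suc.prems Y]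
    by (rule order_trans)
  have "comm_subgroup G ?A (comm_subgroup G ?B Z) \<subseteq> ?K"
    using comm_subgroup_mono [OF order_refl Suc.IH [OF nt(2)]] comm_refined_right [OF Suc.prems Y]
    by (rule order_trans)
  then have 2: "comm_subgroup G (comm_subgroup G ?B Z) ?A \<subseteq> ?K"
    using comm_subgroup_commute [OF normal_carrier [OF n(1)]
        normal_carrier [OF normal_comm_subgroup [OF n(2) assms(2)]]] by simp
  show ?case
    unfolding delta_subgroup_Suc [OF Suc.prems]
    by (rule three_subgroups [OF n assms(2) normal_refined_subgroup [OF Suc.prems Y] 1 2])
qed

section \<open>Derived series inside tuples\<close>

lemma normal_derived_term: "A \<lhd> G \<Longrightarrow> derived_term G A t \<lhd> G"
  by (induction t) (simp_all add: normal_comm_subgroup)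

lemma derived_term_subset: "A \<lhd> G \<Longrightarrow> derived_term G A t \<subseteq> A"
  by (induction t) (auto dest: comm_subgroup_subset(1) [OF normal_derived_term normal_derived_term])

lemma derived_term_antimono:
  assumes "A \<lhd> G" "s \<le> t"
  shows "derived_term G A t \<subseteq> derived_term G A s"
  using assms(2)
proof (induction t rule: dec_induct)
  case (step t)
  note n = normal_derived_term [OF assms(1), of t]
  show ?case using comm_subgroup_subset(1) [OF n n] step.IH by auto
qed simp

lemma derived_term_subset_delta:
  assumes "A \<lhd> G" "normal_tuple G k N" "k \<le> t" "\<And>i. i \<in> {1..2 ^ k} \<Longrightarrow> A \<subseteq> N i"
  shows "derived_term G A t \<subseteq> delta_subgroup G k N"
proof -
  have "derived_term G A k \<subseteq> delta_subgroup G k N"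
    using assms(2,4)
  proof (induction k arbitrary: N)
    case 0
    then show ?case using delta_subgroup_0 [of N] by (simp add: normal_tuple_def)
  next
    case (Suc k)
    have nt: "normal_tuple G k N" "normal_tuple G k (shift k N)"
      using Suc.prems(1) by (simp_all add: normal_tuple_Suc)
    have sub: "\<forall>i\<in>{1..2 ^ Suc k}. A \<subseteq> N i" using Suc.prems(2) by blast
    then show ?case
      unfolding delta_subgroup_Suc [OF Suc.prems(1)] derived_term.simps ball_index_Suc_iff
      using Suc.IH [OF nt(1)] Suc.IH [OF nt(2)] by (intro comm_subgroup_mono) blast+
  qed
  then show ?thesis using derived_term_antimono [OF assms(1,3)] by blast
qed

text \<open>The three subgroups lemma for [[J,J],B] with J = A^(t), where both hypotheses become
  [[J,B],J] \<subseteq> K. One step of the derived series buys a second commutator with J, which can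
  play the part of the missing half of the derived word.\<close>

lemma comm_derived_term_Suc:
  assumes "A \<lhd> G" "B \<lhd> G" "K \<lhd> G" "R \<lhd> G"
    and "comm_subgroup G (derived_term G A t) B \<subseteq> R"
    and "comm_subgroup G R (derived_term G A t) \<subseteq> K"
  shows "comm_subgroup G (derived_term G A (Suc t)) B \<subseteq> K"
proof -
  note n = normal_derived_term [OF assms(1), of t]
  have 1: "comm_subgroup G (comm_subgroup G (derived_term G A t) B) (derived_term G A t) \<subseteq> K"
    using comm_subgroup_mono [OF assms(5) order_refl] assms(6) by (rule order_trans)
  show ?thesis
    unfolding derived_term.simps by (rule three_subgroups [OF n n assms(2,3) 1 1])
qed

text \<open>If both halves have an entry not containing A, the three subgroups lemma reduces to them
  separately. If only one has, all entries of the other contain A, so the other half contains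
  A^(t-1); \<open>comm_derived_term_Suc\<close> then brings that half back in as the second
  commutator. Each level costs at most one derived step, hence k \<le> t.\<close>

lemma comm_derived_term_delta:
  assumes "A \<lhd> G" "normal_tuple G k N" "normal_tuple G k Y" "k \<le> t"
    and "\<exists>p\<in>{1..2 ^ k}. \<not> A \<subseteq> N p"
    and "\<forall>p\<in>{1..2 ^ k}. \<not> A \<subseteq> N p \<longrightarrow> N p \<inter> A \<subseteq> Y p"
  shows "comm_subgroup G (derived_term G A t) (delta_subgroup G k N) \<subseteq> refined_subgroup G k N Y"
  using assms(2-)
proof (induction k arbitrary: N Y t)
  case 0
  then have n: "N 1 \<lhd> G" "Y 1 \<lhd> G" and sub: "N 1 \<inter> A \<subseteq> Y 1" by (simp_all add: normal_tuple_def)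
  have "comm_subgroup G (derived_term G A t) (N 1) \<subseteq> N 1 \<inter> A"
    using comm_subgroup_subset [OF normal_derived_term [OF assms(1)] n(1), of t]
      derived_term_subset [OF assms(1), of t] by blast
  moreover have "delta_subgroup G 0 (N(1 := Y 1)) = Y 1"
    using delta_subgroup_0 [of "N(1 := Y 1)"] n(2) by simp
  ultimately show ?case
    using delta_subgroup_update_subset [of 1 0 N Y] delta_subgroup_0 [of N, OF n(1)] sub by auto
next
  case (Suc k)
  let ?K = "refined_subgroup G (Suc k) N Y"
  let ?A = "delta_subgroup G k N" and ?B = "delta_subgroup G k (shift k N)"
  let ?RA = "refined_subgroup G k N Y" and ?RB = "refined_subgroup G k (shift k N) (shift k Y)"
  obtain s where s: "t = Suc s" "k \<le> s" using Suc.prems(3) by (cases t) auto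
  have nt: "normal_tuple G k N" "normal_tuple G k (shift k N)"
    and nY: "normal_tuple G k Y" "normal_tuple G k (shift k Y)"
    using Suc.prems(1,2) by (simp_all add: normal_tuple_Suc)
  note n = nt [THEN normal_delta_subgroup]
  have K: "?K \<lhd> G" "?RA \<lhd> G" "?RB \<lhd> G"
    by (intro normal_refined_subgroup Suc.prems(1,2) nt nY)+
  note nJ = normal_derived_term [OF assms(1)]
  have Ysub: "\<forall>p\<in>{1..2 ^ k}. \<not> A \<subseteq> N p \<longrightarrow> N p \<inter> A \<subseteq> Y p"
    "\<forall>p\<in>{1..2 ^ k}. \<not> A \<subseteq> shift k N p \<longrightarrow> shift k N p \<inter> A \<subseteq> shift k Y p"
    using Suc.prems(5) unfolding ball_index_Suc_iff by blast+
  have left: "comm_subgroup G ?RA ?B \<subseteq> ?K" using comm_refined_left [OF Suc.prems(1,2)] .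
  have right: "comm_subgroup G ?RB ?A \<subseteq> ?K"
    using comm_refined_right [OF Suc.prems(1,2)]
      comm_subgroup_commute [OF normal_carrier [OF K(3)] normal_carrier [OF n(1)]] by simp
  have commJ: "comm_subgroup G P (derived_term G A u) = comm_subgroup G (derived_term G A u) P"
    if "P \<lhd> G" for P u
    using comm_subgroup_commute [OF normal_carrier [OF that] normal_carrier [OF nJ]] .
  have eq: "comm_subgroup G (derived_term G A t) (delta_subgroup G (Suc k) N) =
      comm_subgroup G (comm_subgroup G ?A ?B) (derived_term G A t)"
    unfolding delta_subgroup_Suc [OF Suc.prems(1)]
    using commJ [OF normal_comm_subgroup [OF n]] by simp
  have RA: "comm_subgroup G (derived_term G A u) ?A \<subseteq> ?RA"
    if "\<exists>p\<in>{1..2 ^ k}. \<not> A \<subseteq> N p" "k \<le> u" for u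
    using Suc.IH [OF nt(1) nY(1) that(2,1) Ysub(1)] .
  have RB: "comm_subgroup G (derived_term G A u) ?B \<subseteq> ?RB"
    if "\<exists>p\<in>{1..2 ^ k}. \<not> A \<subseteq> shift k N p" "k \<le> u" for u
    using Suc.IH [OF nt(2) nY(2) that(2,1) Ysub(2)] .
  consider "\<exists>p\<in>{1..2 ^ k}. \<not> A \<subseteq> N p" "\<exists>p\<in>{1..2 ^ k}. \<not> A \<subseteq> shift k N p"
    | "\<exists>p\<in>{1..2 ^ k}. \<not> A \<subseteq> N p" "\<forall>p\<in>{1..2 ^ k}. A \<subseteq> shift k N p"
    | "\<exists>p\<in>{1..2 ^ k}. \<not> A \<subseteq> shift k N p" "\<forall>p\<in>{1..2 ^ k}. A \<subseteq> N p"
    using Suc.prems(4) unfolding bex_index_Suc_iff by blast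
  then show ?case
  proof cases
    case 1
    have u: "k \<le> t" using s by simp
    have l: "comm_subgroup G (comm_subgroup G ?A (derived_term G A t)) ?B \<subseteq> ?K"
      unfolding commJ [OF n(1)]
      using comm_subgroup_mono [OF RA [OF 1(1) u] order_refl] left by (rule order_trans)
    have r: "comm_subgroup G (comm_subgroup G ?B (derived_term G A t)) ?A \<subseteq> ?K"
      unfolding commJ [OF n(2)]
      using comm_subgroup_mono [OF RB [OF 1(2) u] order_refl] right by (rule order_trans)
    show ?thesis
      unfolding eq by (rule three_subgroups [OF n nJ K(1) l r])
  next
    case 2
    have "derived_term G A s \<subseteq> ?B"
      using derived_term_subset_delta [OF assms(1) nt(2) s(2)] 2(2) by blast
    then have "comm_subgroup G ?RA (derived_term G A s) \<subseteq> ?K"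
      using order_trans [OF comm_subgroup_mono [OF order_refl] left] by blast
    then have *: "comm_subgroup G (derived_term G A t) ?A \<subseteq> ?K"
      unfolding s(1)
      by (rule comm_derived_term_Suc [OF assms(1) n(1) K(1,2) RA [OF 2(1) s(2)]])
    show ?thesis
      unfolding delta_subgroup_Suc [OF Suc.prems(1)]
      by (rule order_trans [OF comm_subgroup_mono [OF order_refl comm_subgroup_subset(1) [OF n]] *])
  next
    case 3
    have "derived_term G A s \<subseteq> ?A"
      using derived_term_subset_delta [OF assms(1) nt(1) s(2)] 3(2) by blast
    then have "comm_subgroup G ?RB (derived_term G A s) \<subseteq> ?K"
      using order_trans [OF comm_subgroup_mono [OF order_refl] right] by blast
    then have *: "comm_subgroup G (derived_term G A t) ?B \<subseteq> ?K"
      unfolding s(1)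
      by (rule comm_derived_term_Suc [OF assms(1) n(2) K(1,3) RB [OF 3(1) s(2)]])
    show ?thesis
      unfolding delta_subgroup_Suc [OF Suc.prems(1)]
      by (rule order_trans [OF comm_subgroup_mono [OF order_refl comm_subgroup_subset(2) [OF n]] *])
  qed
qed


text \<open>Descend into the half that contains l as long as it has an entry not containing A. Once
  it has none, it contributes only a subgroup of A^(t), and the commutator of A^(t) with the other
  half is handled by \<open>comm_derived_term_delta\<close>.\<close>

lemma delta_subgroup_derived_update:
  assumes A: "A \<lhd> G"
    and "normal_tuple G k N" "normal_tuple G k Y" "k \<le> t" "l \<in> {1..2 ^ k}" "A \<subseteq> N l"
    and "\<exists>p\<in>{1..2 ^ k}. \<not> A \<subseteq> N p"
    and "\<forall>p\<in>{1..2 ^ k}. \<not> A \<subseteq> N p \<longrightarrow> N p \<inter> A \<subseteq> Y p"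
  shows "delta_subgroup G k (N(l := derived_term G A t)) \<subseteq> refined_subgroup G k N Y"
  using assms(2-)
proof (induction k arbitrary: N Y l)
  case 0
  \<comment> \<open>Contradictory hypotheses: the only entry would both contain A and fail
    to.\<close>
  then show ?case by simp
next
  case (Suc k)
  let ?K = "refined_subgroup G (Suc k) N Y" and ?J = "derived_term G A t"
  let ?A = "delta_subgroup G k N" and ?B = "delta_subgroup G k (shift k N)"
  let ?RA = "refined_subgroup G k N Y" and ?RB = "refined_subgroup G k (shift k N) (shift k Y)"
  obtain s where s: "t = Suc s" "k \<le> s" "k \<le> t" using Suc.prems(3) by (cases t) auto
  have nt: "normal_tuple G k N" "normal_tuple G k (shift k N)"
    and nY: "normal_tuple G k Y" "normal_tuple G k (shift k Y)"
    using Suc.prems(1,2) by (simp_all add: normal_tuple_Suc)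
  note n = nt [THEN normal_delta_subgroup]
  have K: "?K \<lhd> G" "?RA \<lhd> G" "?RB \<lhd> G"
    by (intro normal_refined_subgroup Suc.prems(1,2) nt nY)+
  note nJ = normal_derived_term [OF A]
  have Ysub: "\<forall>p\<in>{1..2 ^ k}. \<not> A \<subseteq> N p \<longrightarrow> N p \<inter> A \<subseteq> Y p"
    "\<forall>p\<in>{1..2 ^ k}. \<not> A \<subseteq> shift k N p \<longrightarrow> shift k N p \<inter> A \<subseteq> shift k Y p"
    using Suc.prems(7) unfolding ball_index_Suc_iff by blast+
  have left: "comm_subgroup G ?RA ?B \<subseteq> ?K" using comm_refined_left [OF Suc.prems(1,2)] .
  have right: "comm_subgroup G ?A ?RB \<subseteq> ?K" using comm_refined_right [OF Suc.prems(1,2)] .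
  have right': "comm_subgroup G ?RB ?A \<subseteq> ?K"
    using right comm_subgroup_commute [OF normal_carrier [OF K(3)] normal_carrier [OF n(1)]] by simp
  show ?case
  proof (cases "l \<in> {1..2 ^ k}")
    case l: True
    show ?thesis
    proof (cases "\<exists>p\<in>{1..2 ^ k}. \<not> A \<subseteq> N p")
      case True
      show ?thesis
        unfolding delta_subgroup_update_left [OF Suc.prems(1) nJ l]
        using comm_subgroup_mono [OF Suc.IH [OF nt(1) nY(1) s(3) l Suc.prems(5) True Ysub(1)] order_refl] left
        by (rule order_trans)
    next
      case False
      then have bad: "\<exists>p\<in>{1..2 ^ k}. \<not> A \<subseteq> shift k N p"
        using Suc.prems(6) unfolding bex_index_Suc_iff by blast
      have "derived_term G A s \<subseteq> ?A"
        using derived_term_subset_delta [OF A nt(1) s(2)] False by blast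
      then have "comm_subgroup G ?RB (derived_term G A s) \<subseteq> ?K"
        using order_trans [OF comm_subgroup_mono [OF order_refl] right'] by blast
      then have *: "comm_subgroup G ?J ?B \<subseteq> ?K"
        unfolding s(1)
        by (rule comm_derived_term_Suc [OF A n(2) K(1,3)
              comm_derived_term_delta [OF A nt(2) nY(2) s(2) bad Ysub(2)]])
      \<comment> \<open>Only the l-th entry of this half is remembered, since [J,B] already lies in
        the target.\<close>
      have "delta_subgroup G k (N(l := ?J)) \<subseteq> ?J"
        using delta_subgroup_subset [OF normal_tuple_update [OF nt(1) nJ] l, of l] by simp
      then show ?thesis
        unfolding delta_subgroup_update_left [OF Suc.prems(1) nJ l]
        using order_trans [OF comm_subgroup_mono [OF _ order_refl] *] by blast
    qed
  next
    case False
    then obtain q where q: "q \<in> {1..2 ^ k}" "l = 2 ^ k + q"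
      using Suc.prems(4) unfolding index_Suc_iff by blast
    have Aq: "A \<subseteq> shift k N q" using Suc.prems(5) q(2) by simp
    show ?thesis
    proof (cases "\<exists>p\<in>{1..2 ^ k}. \<not> A \<subseteq> shift k N p")
      case True
      show ?thesis
        unfolding q(2) delta_subgroup_update_right [OF Suc.prems(1) nJ q(1)]
        using comm_subgroup_mono [OF order_refl Suc.IH [OF nt(2) nY(2) s(3) q(1) Aq True Ysub(2)]] right
        by (rule order_trans)
    next
      case False
      then have bad: "\<exists>p\<in>{1..2 ^ k}. \<not> A \<subseteq> N p"
        using Suc.prems(6) unfolding bex_index_Suc_iff by blast
      have "derived_term G A s \<subseteq> ?B"
        using derived_term_subset_delta [OF A nt(2) s(2)] False by blast
      then have "comm_subgroup G ?RA (derived_term G A s) \<subseteq> ?K"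
        using order_trans [OF comm_subgroup_mono [OF order_refl] left] by blast
      then have "comm_subgroup G ?J ?A \<subseteq> ?K"
        unfolding s(1)
        by (rule comm_derived_term_Suc [OF A n(1) K(1,2)
              comm_derived_term_delta [OF A nt(1) nY(1) s(2) bad Ysub(1)]])
      then have *: "comm_subgroup G ?A ?J \<subseteq> ?K"
        using comm_subgroup_commute [OF normal_carrier [OF nJ] normal_carrier [OF n(1)]] by simp
      have "delta_subgroup G k ((shift k N)(q := ?J)) \<subseteq> ?J"
        using delta_subgroup_subset [OF normal_tuple_update [OF nt(2) nJ] q(1), of q] by simp
      then show ?thesis
        unfolding q(2) delta_subgroup_update_right [OF Suc.prems(1) nJ q(1)]
        using order_trans [OF comm_subgroup_mono [OF order_refl] *] by blast
    qed
  qed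
qed

section \<open>Powers of values\<close>

lemma commutator_eq_one_iff:
  assumes "x \<in> carrier G" "y \<in> carrier G"
  shows "commutator G x y = \<one> \<longleftrightarrow> x \<otimes> y = y \<otimes> x"
proof -
  have "commutator G x y = inv (y \<otimes> x) \<otimes> (x \<otimes> y)"
    using assms by (simp add: group_word_simps)
  then show ?thesis
    using assms by (simp add: inv_solve_left')
qed

lemma commute_pow:
  assumes "x \<in> carrier G" "y \<in> carrier G" "x \<otimes> y = y \<otimes> x"
  shows "x [^] (n::nat) \<otimes> y = y \<otimes> x [^] n"
proof (induction n)
  case (Suc n)
  have "x [^] Suc n \<otimes> y = x [^] n \<otimes> y \<otimes> x"
    using assms by (simp add: m_assoc)
  then show ?case using assms Suc by (simp add: m_assoc)
qed (use assms in simp)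

lemma commutator_pow_left:
  assumes "f \<in> carrier G" "b \<in> carrier G" "commutator G (commutator G f b) f = \<one>"
  shows "commutator G (f [^] (n::nat)) b = commutator G f b [^] n"
proof (induction n)
  case 0
  then show ?case using assms by (simp add: commutator_def)
next
  case (Suc n)
  let ?c = "commutator G f b"
  have c: "?c \<in> carrier G" "?c [^] n \<in> carrier G" using assms by auto
  have "?c [^] n \<otimes> f = f \<otimes> ?c [^] n"
    using commute_pow [OF c(1) assms(1)] assms by (simp add: commutator_eq_one_iff)
  then have "inv f \<otimes> ?c [^] n \<otimes> f = ?c [^] n"
    using assms(1) c by (simp add: m_assoc inv_mult_cancel)
  then show ?case
    using assms c Suc by (simp add: commutator_mult_left)
qed

text \<open>The factor v stands for the error that the induction in \<open>geval_delta_pow\<close>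
  has already produced in one half: [f^n v, b] = v^-1 [f^n,b] v [v,b], and both traces of v
  disappear.\<close>

lemma commutator_pow_mult_left:
  assumes "f \<in> carrier G" "b \<in> carrier G" "v \<in> carrier G"
    and "commutator G (commutator G f b) f = \<one>" "commutator G v b = \<one>"
    and "commutator G (commutator G (f [^] (n::nat)) b) v = \<one>"
  shows "commutator G (f [^] n \<otimes> v) b = commutator G f b [^] n"
proof -
  let ?c = "commutator G (f [^] n) b"
  have "?c \<otimes> v = v \<otimes> ?c" using assms by (simp add: commutator_eq_one_iff)
  then have "inv v \<otimes> ?c \<otimes> v = ?c" using assms by (simp add: m_assoc inv_mult_cancel)
  then show ?thesis
    using assms by (simp add: commutator_mult_left commutator_pow_left)
qed

lemma commutator_pow_mult_right:
  assumes "f \<in> carrier G" "b \<in> carrier G" "v \<in> carrier G"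
    and "commutator G (commutator G f b) f = \<one>" "commutator G v b = \<one>"
    and "commutator G (commutator G (f [^] (n::nat)) b) v = \<one>"
  shows "commutator G b (f [^] n \<otimes> v) = commutator G b f [^] n"
proof -
  have "commutator G b (f [^] n \<otimes> v) = inv (commutator G (f [^] n \<otimes> v) b)"
    using assms(1-3) by (simp add: inv_commutator)
  also have "\<dots> = inv (commutator G f b) [^] n"
    using assms(1-3) commutator_pow_mult_left [OF assms] by (simp add: nat_pow_inv)
  finally show ?thesis using assms(1,2) by (simp add: inv_commutator)
qed

end

lemma (in group_hom) hom_commutator:
  "x \<in> carrier G \<Longrightarrow> y \<in> carrier G \<Longrightarrow> h (commutator G x y) = commutator H (h x) (h y)"
  by (simp add: commutator_def)

context group
begin

text \<open>In \<open>G Mod K\<close> the three memberships become exact commutation relations, so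
  the preceding identities apply there and are read back up to a factor in K.\<close>

lemma commutator_pow_mod:
  assumes K: "K \<lhd> G" and car: "f \<in> carrier G" "b \<in> carrier G" "v \<in> carrier G"
    and "commutator G (commutator G f b) f \<in> K" "commutator G v b \<in> K"
    and "commutator G (commutator G (f [^] (n::nat)) b) v \<in> K"
  shows "\<exists>u\<in>K. commutator G (f [^] n \<otimes> v) b = commutator G f b [^] n \<otimes> u"
    and "\<exists>u\<in>K. commutator G b (f [^] n \<otimes> v) = commutator G b f [^] n \<otimes> u"
proof -
  interpret K: normal K G by fact
  let ?Q = "G Mod K" and ?h = "\<lambda>x. K #> x"
  interpret h: group_hom G ?Q ?h
    using K.r_coset_hom_Mod K.factorgroup_is_group
    by (simp add: group_hom_def group_hom_axioms_def group_axioms)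
  have one: "?h x = \<one>\<^bsub>?Q\<^esub>" if "x \<in> K" for x
    using that K.subset by (simp add: FactGroup_def coset_join2 K.subgroup_axioms subset_iff)
  have eq: "\<exists>u\<in>K. x = y \<otimes> u" if "x \<in> carrier G" "y \<in> carrier G" "?h x = ?h y" for x y
  proof -
    have "x \<in> K #> y" using that K.subgroup_axioms rcos_self by blast
    then obtain w where w: "w \<in> K" "x = w \<otimes> y" by (auto simp: r_coset_def)
    \<comment> \<open>Cosets here are K y, so the factor from K is conjugated to stand on the
      right.\<close>
    then have "x = y \<otimes> (inv y \<otimes> w \<otimes> y)" using that(2) K.subset by (simp add: m_assoc inv_mult_cancel)
    then show ?thesis using normal_conj(2) [OF K w(1) that(2)] by blast
  qed
  have "commutator ?Q (commutator ?Q (?h f) (?h b)) (?h f) = \<one>\<^bsub>?Q\<^esub>"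
    "commutator ?Q (?h v) (?h b) = \<one>\<^bsub>?Q\<^esub>"
    "commutator ?Q (commutator ?Q (?h f [^]\<^bsub>?Q\<^esub> n) (?h b)) (?h v) = \<one>\<^bsub>?Q\<^esub>"
    using one [OF assms(5)] one [OF assms(6)] one [OF assms(7)] car
    by (simp_all add: h.hom_commutator h.hom_nat_pow)
  note Q = this
  have "?h (commutator G (f [^] n \<otimes> v) b) = ?h (commutator G f b [^] n)"
    using h.H.commutator_pow_mult_left [OF h.hom_closed h.hom_closed h.hom_closed Q] car
    by (simp add: h.hom_commutator h.hom_nat_pow)
  then show "\<exists>u\<in>K. commutator G (f [^] n \<otimes> v) b = commutator G f b [^] n \<otimes> u"
    using car by (intro eq) auto
  have "?h (commutator G b (f [^] n \<otimes> v)) = ?h (commutator G b f [^] n)"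
    using h.H.commutator_pow_mult_right [OF h.hom_closed h.hom_closed h.hom_closed Q] car
    by (simp add: h.hom_commutator h.hom_nat_pow)
  then show "\<exists>u\<in>K. commutator G b (f [^] n \<otimes> v) = commutator G b f [^] n \<otimes> u"
    using car by (intro eq) auto
qed

text \<open>Modulo the subgroup \<open>V\<close> of the tuples in which some \<open>M l\<close> is replaced by \<open>[M l, M j]\<close>, the
  subgroup \<open>M j\<close> centralizes all values. Hence \<open>\<delta>\<^sub>k\<close> turns powers in the \<open>j\<close>-th variable into powers.\<close>

lemma geval_delta_pow:
  assumes "normal_tuple G k M" "j \<in> {1..2 ^ k}" "\<forall>i\<in>{1..2 ^ k}. g i \<in> M i"
  shows "\<exists>v\<in>refined_subgroup G k M (\<lambda>l. comm_subgroup G (M l) (M j)).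
    geval G (g(j := g j [^] (n::nat))) (delta_word k) = geval G g (delta_word k) [^] n \<otimes> v"
  using assms
proof (induction k arbitrary: M j g)
  case 0
  then have j: "j = 1" and M1: "M 1 \<lhd> G" and g: "g 1 \<in> carrier G"
    using normal_carrier by (auto simp: normal_tuple_def)
  let ?V = "refined_subgroup G 0 M (\<lambda>l. comm_subgroup G (M l) (M j))"
  have "?V \<lhd> G"
    using 0 M1 j by (intro normal_refined_subgroup normal_tuple_comm) auto
  then have "\<one> \<in> ?V" by (intro subgroup.one_closed normal_imp_subgroup)
  then show ?case using j g by (intro bexI [of _ \<one>]) auto
next
  case (Suc k)
  have Mj: "M j \<lhd> G" using Suc.prems(1,2) by (simp add: normal_tuple_def)
  let ?Y = "\<lambda>l. comm_subgroup G (M l) (M j)"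
  let ?K = "refined_subgroup G (Suc k) M ?Y"
  let ?A = "delta_subgroup G k M" and ?B = "delta_subgroup G k (shift k M)"
  have Y: "normal_tuple G (Suc k) ?Y" using Suc.prems(1) Mj by (rule normal_tuple_comm)
  have K: "?K \<lhd> G" using Suc.prems(1) Y by (rule normal_refined_subgroup)
  note sgK = normal_imp_subgroup [OF K]
  have nt: "normal_tuple G k M" "normal_tuple G k (shift k M)"
    using Suc.prems(1) by (simp_all add: normal_tuple_Suc)
  note n = nt [THEN normal_delta_subgroup]
  have g: "\<forall>i\<in>{1..2 ^ k}. g i \<in> M i" "\<forall>i\<in>{1..2 ^ k}. shift k g i \<in> shift k M i"
    using Suc.prems(3) unfolding ball_index_Suc_iff by blast+
  let ?a = "geval G g (delta_word k)" and ?b = "geval G (shift k g) (delta_word k)"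
  have "?a \<in> delta_values G k M" "?b \<in> delta_values G k (shift k M)"
    using g unfolding word_values_def by blast+
  then have ab: "?a \<in> ?A" "?b \<in> ?B" using delta_values_subset_subgroup by blast+
  then have abc: "?a \<in> carrier G" "?b \<in> carrier G" using n [THEN normal_carrier] by blast+
  have central: "commutator G c z \<in> ?K" if "c \<in> delta_subgroup G (Suc k) M" "z \<in> M j" for c z
    using comm_delta_subgroup [OF Suc.prems(1) Mj] commutator_in_comm_subgroup [OF that] by blast
  have AB: "commutator G a b \<in> delta_subgroup G (Suc k) M"
    "commutator G b a \<in> delta_subgroup G (Suc k) M" if "a \<in> ?A" "b \<in> ?B" for a b
    unfolding delta_subgroup_Suc [OF Suc.prems(1)]
    using commutator_in_comm_subgroup [OF that] commutator_in_comm_subgroup [OF that(2,1)]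
      comm_subgroup_commute [OF normal_carrier [OF n(2)] normal_carrier [OF n(1)]]
    by simp_all
  \<comment> \<open>The error from a half whose i-th entry is M j stays in M j: the i-th entry of
    each factor is M j or [M j, M j]. Hence this error commutes with the values modulo the
    target.\<close>
  have sub: "refined_subgroup G k N (\<lambda>l. comm_subgroup G (N l) (M j)) \<subseteq> M j"
    if "normal_tuple G k N" "i \<in> {1..2 ^ k}" "N i = M j" for N i
  proof (rule refined_subgroup_subset [OF normal_imp_subgroup [OF Mj]])
    fix p :: nat assume p: "p \<in> {1..2 ^ k}"
    have Np: "N p \<lhd> G" using that(1) p by (simp add: normal_tuple_def)
    have "delta_subgroup G k (N(p := comm_subgroup G (N p) (M j)))
        \<subseteq> (N(p := comm_subgroup G (N p) (M j))) i"
      by (intro delta_subgroup_subset normal_tuple_update normal_comm_subgroup that Np Mj)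
    then show "delta_subgroup G k (N(p := comm_subgroup G (N p) (M j))) \<subseteq> M j"
      using that(3) comm_subgroup_subset(2) [OF Np Mj] by (auto split: if_splits)
  qed
  show ?case
  proof (cases "j \<in> {1..2 ^ k}")
    case j: True
    let ?V = "refined_subgroup G k M ?Y"
    obtain v where v: "v \<in> ?V"
        "geval G (g(j := g j [^] n)) (delta_word k) = ?a [^] n \<otimes> v"
      using Suc.IH [OF nt(1) j g(1)] by blast
    have vM: "v \<in> M j" using sub [OF nt(1) j] v(1) by blast
    then have vc: "v \<in> carrier G" using normal_carrier [OF Mj] by blast
    have "geval G (shift k (g(j := g j [^] n))) (delta_word k) = ?b"
      using j by (intro geval_delta_cong) auto
    then have eq: "geval G (g(j := g j [^] n)) (delta_word (Suc k)) = commutator G (?a [^] n \<otimes> v) ?b"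
      by (simp only: geval_delta_Suc v(2))
    have vb: "commutator G v ?b \<in> ?K"
      using comm_refined_left [OF Suc.prems(1) Y] commutator_in_comm_subgroup [OF v(1) ab(2)] by blast
    \<comment> \<open>The index j belongs to this half, so the value a itself lies in M j and
      commutes with [a,b] modulo the target.\<close>
    have aM: "?a \<in> M j" using ab(1) delta_subgroup_subset [OF nt(1) j] by blast
    have pow: "?a [^] n \<in> ?A" using normal_imp_subgroup [OF n(1)] ab(1) by (induction n) (auto simp: subgroup.one_closed subgroup.m_closed)
    show ?thesis
      unfolding eq geval_delta_Suc [of G g]
      using commutator_pow_mod(1) [OF K abc vc central [OF AB(1) [OF ab] aM] vb
          central [OF AB(1) [OF pow ab(2)] vM]] .
  next
    case False
    then obtain q where q: "q \<in> {1..2 ^ k}" "j = 2 ^ k + q"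
      using Suc.prems(2) unfolding index_Suc_iff by blast
    let ?V = "refined_subgroup G k (shift k M) (shift k ?Y)"
    have "\<exists>v\<in>?V. geval G ((shift k g)(q := shift k g q [^] n)) (delta_word k) = ?b [^] n \<otimes> v"
      using Suc.IH [OF nt(2) q(1) g(2)] by (simp only: q(2))
    then obtain v where v: "v \<in> ?V"
        "geval G ((shift k g)(q := shift k g q [^] n)) (delta_word k) = ?b [^] n \<otimes> v"
      by blast
    have vM: "v \<in> M j" using sub [OF nt(2) q(1)] v(1) by (auto simp: q(2))
    then have vc: "v \<in> carrier G" using normal_carrier [OF Mj] by blast
    have "geval G (g(j := g j [^] n)) (delta_word k) = ?a"
      using q by (intro geval_delta_cong) auto
    moreover have "shift k (g(j := g j [^] n)) = (shift k g)(q := shift k g q [^] n)"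
      by (auto simp: fun_eq_iff q(2))
    ultimately have eq: "geval G (g(j := g j [^] n)) (delta_word (Suc k)) = commutator G ?a (?b [^] n \<otimes> v)"
      by (simp only: geval_delta_Suc v(2))
    have "commutator G ?a v \<in> ?K"
      using comm_refined_right [OF Suc.prems(1) Y] commutator_in_comm_subgroup [OF ab(1) v(1)] by blast
    then have va: "commutator G v ?a \<in> ?K"
      using subgroup.m_inv_closed [OF sgK] inv_commutator [OF abc(1) vc] by fastforce
    have bM: "?b \<in> M j" using ab(2) delta_subgroup_subset [OF nt(2) q(1)] q(2) by blast
    have pow: "?b [^] n \<in> ?B" using normal_imp_subgroup [OF n(2)] ab(2) by (induction n) (auto simp: subgroup.one_closed subgroup.m_closed)
    show ?thesis
      unfolding eq geval_delta_Suc [of G g]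
      using commutator_pow_mod(2) [OF K abc(2,1) vc central [OF AB(2) [OF ab] bM] va
          central [OF AB(2) [OF ab(1) pow] vM]] .
  qed
qed

text \<open>For a value x each power satisfies x^n v \<in> X with some v \<in> V, X being the set of
  values. So the powers lie in the product set of X and V, which has at most m * b elements, and two
  of x^0, ..., x^(m*b) coincide.\<close>

lemma finite_delta_subgroup_step:
  assumes M: "normal_tuple G k M" and j: "j \<in> {1..2 ^ k}"
    and fin: "finite (delta_values G k M)" "card (delta_values G k M) \<le> m"
  defines "V \<equiv> refined_subgroup G k M (\<lambda>l. comm_subgroup G (M l) (M j))"
  assumes V: "finite V" "card V \<le> b"
  shows "finite (delta_subgroup G k M) \<and> card (delta_subgroup G k M) \<le> collect_bound (2 * m) (m * b)"
proof -
  let ?X = "delta_values G k M"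
  have ord: "\<exists>p. 0 < p \<and> p \<le> m * b \<and> x [^] p = \<one>" if x: "x \<in> ?X" for x
  proof -
    obtain g where g: "x = geval G g (delta_word k)" "\<forall>i\<in>{1..2 ^ k}. g i \<in> M i"
      using x unfolding word_values_def by blast
    have xc: "x \<in> carrier G" using x delta_values_conj(1) [OF M] by blast
    have nM: "M j \<lhd> G" using M j by (simp add: normal_tuple_def)
    have nV: "V \<lhd> G"
      unfolding V_def by (intro normal_refined_subgroup normal_tuple_comm M nM)
    let ?P = "(\<lambda>(y, v). y \<otimes> v) ` (?X \<times> V)"
    have P: "finite ?P" "card ?P \<le> m * b"
    proof -
      show "finite ?P" using fin V by simp
      have "card ?P \<le> card (?X \<times> V)" using fin V by (intro card_image_le) simp
      also have "\<dots> \<le> m * b" using fin V by (simp add: card_cartesian_product mult_le_mono)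
      finally show "card ?P \<le> m * b" .
    qed
    have pow: "x [^] n \<in> ?P" for n :: nat
    proof -
      let ?h = "g(j := g j [^] n)"
      obtain v where v: "v \<in> V" "geval G ?h (delta_word k) = x [^] n \<otimes> v"
        using geval_delta_pow [OF M j g(2)] unfolding g(1) V_def by blast
      have "g j [^] n \<in> M j"
        using g(2) j normal_imp_subgroup [OF nM]
        by (induction n) (auto simp: subgroup.one_closed subgroup.m_closed)
      then have "geval G ?h (delta_word k) \<in> ?X"
        unfolding word_values_def using g(2) by (intro CollectI exI [of _ ?h]) auto
      moreover have "inv v \<in> V" "v \<in> carrier G"
        using subgroup.m_inv_closed [OF normal_imp_subgroup [OF nV] v(1)]
          subsetD [OF normal_carrier [OF nV] v(1)] .
      moreover have "x [^] n = (x [^] n \<otimes> v) \<otimes> inv v"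
        using xc \<open>v \<in> carrier G\<close> by (simp add: m_assoc)
      ultimately show ?thesis unfolding v(2) by (intro image_eqI [of _ _ "(x [^] n \<otimes> v, inv v)"]) auto
    qed
    have "\<not> inj_on (\<lambda>i::nat. x [^] i) {..m * b}"
    proof
      assume "inj_on (\<lambda>i::nat. x [^] i) {..m * b}"
      then have "card {..m * b} \<le> card ?P"
        using pow P(1) by (intro card_inj_on_le) auto
      then show False using P(2) by simp
    qed
    then obtain i i' :: nat where i: "i < i'" "i' \<le> m * b" "x [^] i = x [^] i'"
      unfolding inj_on_def by (metis atMost_iff linorder_neqE_nat)
    have "x [^] i \<otimes> x [^] (i' - i) = x [^] i'"
      using xc i(1) by (simp add: nat_pow_mult)
    then have "x [^] (i' - i) = \<one>"
      using xc i(3) by (metis l_cancel nat_pow_closed one_closed r_one)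
    then show ?thesis using i by (intro exI [of _ "i' - i"]) auto
  qed
  have "finite (delta_subgroup G k M) \<and>
      card (delta_subgroup G k M) \<le> collect_bound (2 * card ?X) (m * b)"
    unfolding word_subgroup_def
    using delta_values_conj [OF M] fin(1) ord by (intro Dietzmann)
  then show ?thesis
    using collect_bound_mono [of "2 * card ?X" "2 * m" "m * b" "m * b"] fin(2) by auto
qed

end

section \<open>Bounding the order\<close>

text \<open>If b bounds each of the 2 ^ k factors of a refined subgroup, then b ^ 2 ^ k bounds the
  whole. The first summand is Dietzmann's bound for that V, the second covers subgroups inside a
  refined subgroup. The sum serves \<open>delta_small_step\<close> and
  \<open>delta_small_refined\<close> alike and is at least b.\<close>

definition step_bound :: "nat \<Rightarrow> nat \<Rightarrow> nat \<Rightarrow> nat" where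
  "step_bound k m b = collect_bound (2 * m) (m * b ^ 2 ^ k) + b ^ 2 ^ k"

definition iter_bound :: "nat \<Rightarrow> nat \<Rightarrow> nat \<Rightarrow> nat" where
  "iter_bound k m s = (step_bound k m ^^ s) (schur_bound m)"

definition delta_small :: "('a, 'b) monoid_scheme \<Rightarrow> nat \<Rightarrow> nat \<Rightarrow> nat \<Rightarrow> (nat \<Rightarrow> 'a set) \<Rightarrow> bool" where
  "delta_small G k m s M \<longleftrightarrow>
     finite (delta_subgroup G k M) \<and> card (delta_subgroup G k M) \<le> iter_bound k m s"

text \<open>A chain costs at most 2 ^ k * (k + 2) steps: 2 ^ k entries with at most k + 2 moves
  each. The number of entries not containing A can drop at most 2 ^ k times; each drop costs one
  chain and one step for the deep end, and the outermost chain is added.\<close>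

definition order_bound :: "nat \<Rightarrow> nat \<Rightarrow> nat" where
  "order_bound m k = iter_bound k m (2 ^ k * (2 ^ k * (k + 2) + 1) + 2 ^ k * (k + 2))"

lemma le_step_bound: "b \<le> step_bound k m b"
proof -
  have "b \<le> b ^ 2 ^ k" by (cases b) (simp_all add: self_le_power)
  then show ?thesis by (simp add: step_bound_def)
qed

lemma iter_bound_Suc: "iter_bound k m (Suc s) = step_bound k m (iter_bound k m s)"
  by (simp add: iter_bound_def)

lemma iter_bound_mono: "s \<le> s' \<Longrightarrow> iter_bound k m s \<le> iter_bound k m s'"
  by (rule lift_Suc_mono_le) (simp_all add: iter_bound_Suc le_step_bound)

lemma iter_bound_pos: "1 \<le> iter_bound k m s"
proof -
  have "1 \<le> iter_bound k m 0"
    unfolding iter_bound_def schur_bound_def using collect_bound_pos by simp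
  then show ?thesis using iter_bound_mono [of 0 s k m] by simp
qed

lemma delta_small_mono: "delta_small G k m s M \<Longrightarrow> s \<le> s' \<Longrightarrow> delta_small G k m s' M"
  unfolding delta_small_def using iter_bound_mono order_trans by blast

lemma delta_small_subset:
  "delta_small G k m s M \<Longrightarrow> delta_subgroup G k M' \<subseteq> delta_subgroup G k M \<Longrightarrow> delta_small G k m s M'"
  unfolding delta_small_def by (meson card_mono finite_subset order_trans)

context group
begin

text \<open>The factors are normal, so they can be adjoined one at a time as set products,
  multiplying the order by at most b.\<close>

lemma finite_generate_UN:
  assumes "finite J" "\<And>p. p \<in> J \<Longrightarrow> A p \<lhd> G"
    and "\<And>p. p \<in> J \<Longrightarrow> finite (A p) \<and> card (A p) \<le> b"
  shows "finite (generate G (\<Union>p\<in>J. A p)) \<and> card (generate G (\<Union>p\<in>J. A p)) \<le> b ^ card J"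
  using assms
proof (induction J)
  case empty
  then show ?case by (simp add: generate_empty)
next
  case (insert q J)
  let ?U = "\<Union>p\<in>J. A p"
  have U: "?U \<subseteq> carrier G" using insert.prems(1) by (intro UN_least normal_carrier) simp
  have n: "A q \<lhd> G" using insert.prems(1) by simp
  have sg: "subgroup (A q <#> generate G ?U) G"
    using n generate_is_subgroup [OF U] by (rule mult_norm_subgroup)
  have IH: "finite (generate G ?U)" "card (generate G ?U) \<le> b ^ card J"
    and q: "finite (A q)" "card (A q) \<le> b"
    using insert by auto
  have "A q \<union> ?U \<subseteq> A q <#> generate G ?U"
  proof
    fix x assume "x \<in> A q \<union> ?U"
    then consider "x \<in> A q" | "x \<in> ?U" by blast
    then show "x \<in> A q <#> generate G ?U"
    proof cases
      case 1
      then have "x = x \<otimes> \<one>" using normal_carrier [OF n] by auto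
      then show ?thesis using 1 generate.one unfolding set_mult_def by blast
    next
      case 2
      then have "x = \<one> \<otimes> x" using U by auto
      then show ?thesis
        using generate.incl [OF 2, of G] subgroup.one_closed [OF normal_imp_subgroup [OF n]]
        unfolding set_mult_def by blast
    qed
  qed
  then have "generate G (A q \<union> ?U) \<subseteq> A q <#> generate G ?U"
    using sg by (rule generate_subgroup_incl)
  moreover have "A q <#> generate G ?U = (\<lambda>(x, y). x \<otimes> y) ` (A q \<times> generate G ?U)"
    by (auto simp: set_mult_def)
  ultimately have sub: "generate G (A q \<union> ?U) \<subseteq> (\<lambda>(x, y). x \<otimes> y) ` (A q \<times> generate G ?U)" by simp
  have fin: "finite (A q \<times> generate G ?U)" using IH q by simp
  have "card (generate G (A q \<union> ?U)) \<le> card (A q \<times> generate G ?U)"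
    using sub fin by (meson card_image_le card_mono finite_imageI order_trans)
  also have "\<dots> \<le> b ^ card (insert q J)"
    using IH q insert.hyps by (simp add: card_cartesian_product mult_le_mono)
  finally show ?case using finite_subset [OF sub] fin by simp
qed

lemma finite_refined_subgroup:
  assumes "normal_tuple G k N" "normal_tuple G k Y"
    and "\<And>p. p \<in> {1..2 ^ k} \<Longrightarrow> delta_small G k m s (N(p := Y p))"
  shows "finite (refined_subgroup G k N Y) \<and> card (refined_subgroup G k N Y) \<le> iter_bound k m s ^ 2 ^ k"
proof -
  have "delta_subgroup G k (N(p := Y p)) \<lhd> G" if "p \<in> {1..2 ^ k}" for p
    using assms(1,2) that by (intro normal_delta_subgroup normal_tuple_update) (simp_all add: normal_tuple_def)
  then show ?thesis
    using finite_generate_UN [of "{1..2 ^ k}" "\<lambda>p. delta_subgroup G k (N(p := Y p))" "iter_bound k m s"]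
      assms(3) by (simp add: refined_subgroup_def delta_small_def)
qed

lemma delta_small_refined:
  assumes "normal_tuple G k N" "normal_tuple G k Y"
    and "\<And>p. p \<in> {1..2 ^ k} \<Longrightarrow> delta_small G k m s (N(p := Y p))"
    and "delta_subgroup G k M \<subseteq> refined_subgroup G k N Y"
  shows "delta_small G k m (Suc s) M"
proof -
  have fin: "finite (refined_subgroup G k N Y)"
    and card: "card (refined_subgroup G k N Y) \<le> iter_bound k m s ^ 2 ^ k"
    using finite_refined_subgroup assms(1-3) by blast+
  have "card (delta_subgroup G k M) \<le> iter_bound k m s ^ 2 ^ k"
    using card card_mono [OF fin assms(4)] by simp
  also have "\<dots> \<le> iter_bound k m (Suc s)" by (simp add: iter_bound_Suc step_bound_def)
  finally show ?thesis using finite_subset [OF assms(4) fin] by (simp add: delta_small_def)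
qed

lemma delta_small_step:
  assumes M: "normal_tuple G k M" and j: "j \<in> {1..2 ^ k}"
    and fin: "finite (delta_values G k M)" "card (delta_values G k M) \<le> m"
    and small: "\<And>l. l \<in> {1..2 ^ k} \<Longrightarrow> delta_small G k m s (M(l := comm_subgroup G (M l) (M j)))"
  shows "delta_small G k m (Suc s) M"
proof -
  have "M j \<lhd> G" using M j by (simp add: normal_tuple_def)
  then have "normal_tuple G k (\<lambda>l. comm_subgroup G (M l) (M j))" using M by (intro normal_tuple_comm)
  then have "finite (refined_subgroup G k M (\<lambda>l. comm_subgroup G (M l) (M j)))"
    "card (refined_subgroup G k M (\<lambda>l. comm_subgroup G (M l) (M j))) \<le> iter_bound k m s ^ 2 ^ k"
    using finite_refined_subgroup [OF M _ small] by auto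
  then have "finite (delta_subgroup G k M) \<and>
      card (delta_subgroup G k M) \<le> collect_bound (2 * m) (m * iter_bound k m s ^ 2 ^ k)"
    using finite_delta_subgroup_step [OF M j fin] by blast
  then show ?thesis by (auto simp: delta_small_def iter_bound_Suc step_bound_def)
qed

section \<open>Chains of tuples and the main induction\<close>

definition chain_term :: "'a set \<Rightarrow> 'a set \<Rightarrow> nat \<Rightarrow> 'a set" where
  "chain_term A B t = (case t of 0 \<Rightarrow> B | Suc s \<Rightarrow> derived_term G A s)"

lemma normal_chain_term: "A \<lhd> G \<Longrightarrow> B \<lhd> G \<Longrightarrow> chain_term A B t \<lhd> G"
  by (simp add: chain_term_def normal_derived_term split: nat.split)

lemma chain_term_subset:
  assumes "A \<lhd> G" "A \<subseteq> B"
  shows "chain_term A B t \<subseteq> B"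
  using derived_term_subset [OF assms(1)] assms(2) by (auto simp: chain_term_def split: nat.split)

text \<open>A depth t \<ge> 1 puts the second term inside A, where the chain no longer depends on
  its top C; chains of different entries can thus be combined. For s = 0 the commutator falls into
  A, and for larger s the inequality s \<le> t sends it to the next derived subgroup.\<close>

lemma comm_chain_term:
  assumes A: "A \<lhd> G" and B: "B \<lhd> G" and "s \<le> t" "1 \<le> t"
  shows "comm_subgroup G (chain_term A B s) (chain_term A C t) \<subseteq> chain_term A B (Suc s)"
proof -
  obtain u where u: "t = Suc u" using assms(4) by (cases t) auto
  note n = normal_derived_term [OF A]
  show ?thesis
  proof (cases s)
    case 0
    have "comm_subgroup G B (derived_term G A u) \<subseteq> A"
      using comm_subgroup_subset(2) [OF B n] derived_term_subset [OF A] by (rule order_trans)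
    then show ?thesis by (simp add: chain_term_def u 0)
  next
    case (Suc v)
    then have "derived_term G A u \<subseteq> derived_term G A v"
      using derived_term_antimono [OF A] assms(3) u by simp
    then show ?thesis
      by (simp add: chain_term_def u Suc comm_subgroup_mono)
  qed
qed

text \<open>The variable \<open>j\<close> of \<open>delta_small_step\<close> is one whose entry lies deepest in the chain
  \<open>N i \<supseteq> A \<supseteq> A' \<supseteq> \<dots>\<close>: then every commutator \<open>[M l, M j]\<close> lies one step deeper than \<open>M l\<close>.\<close>

lemma delta_small_chain:
  assumes N: "normal_tuple G k N" and A: "A \<lhd> G"
    and fin: "finite (delta_values G k N)" "card (delta_values G k N) \<le> m"
  defines "S \<equiv> {i \<in> {1..2 ^ k}. A \<subseteq> N i}"
  assumes out: "\<And>p. p \<in> {1..2 ^ k} - S \<Longrightarrow> delta_small G k m s (N(p := N p \<inter> A))"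
    and deep: "\<And>l. l \<in> S \<Longrightarrow> delta_small G k m s (N(l := derived_term G A t))"
    and a: "\<exists>i\<in>S. 1 \<le> a i" "\<forall>i\<in>S. a i \<le> Suc t"
  shows "delta_small G k m (s + (\<Sum>i\<in>S. Suc t - a i)) (\<lambda>i. if i \<in> S then chain_term A (N i) (a i) else N i)"
  using a
proof (induction "\<Sum>i\<in>S. Suc t - a i" arbitrary: a rule: less_induct)
  case less
  let ?M = "\<lambda>a i. if i \<in> S then chain_term A (N i) (a i) else N i"
  have finS: "finite S" by (simp add: S_def)
  have S: "i \<in> {1..2 ^ k}" "A \<subseteq> N i" if "i \<in> S" for i using that by (simp_all add: S_def)
  have Nn: "N i \<lhd> G" if "i \<in> {1..2 ^ k}" for i using N that by (simp add: normal_tuple_def)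
  have sub: "?M a i \<subseteq> N i" for i
    using chain_term_subset [OF A] S by simp
  have M: "normal_tuple G k (?M a)"
    unfolding normal_tuple_def using Nn normal_chain_term [OF A] by simp
  show ?case
  proof (cases "\<exists>l\<in>S. a l = Suc t")
    case True
    then obtain l where l: "l \<in> S" "a l = Suc t" by blast
    \<comment> \<open>Depth t + 1 is A^(t): an entry has reached the end of its chain, and the tuple
      lies entrywise below one covered by \<open>deep\<close>.\<close>
    have "delta_subgroup G k (?M a) \<subseteq> delta_subgroup G k (N(l := derived_term G A t))"
    proof (rule delta_subgroup_mono)
      show "?M a i \<subseteq> (N(l := derived_term G A t)) i" for i
        using sub [of i] l by (cases "i = l") (simp_all add: chain_term_def)
    qed
    then show ?thesis
      by (rule delta_small_mono [OF delta_small_subset [OF deep [OF l(1)]]]) simp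
  next
    case False
    then have lt: "\<forall>i\<in>S. a i < Suc t" using less.prems(2) by (meson le_neq_implies_less)
    have "Max (a ` S) \<in> a ` S" using finS less.prems(1) by (intro Max_in) auto
    then obtain j where j: "j \<in> S" "Max (a ` S) = a j" by blast
    have max: "a i \<le> a j" if "i \<in> S" for i
      unfolding j(2) [symmetric] using finS that by (intro Max_ge) auto
    then have aj: "1 \<le> a j" using less.prems(1) order_trans by blast
    let ?n = "\<Sum>i\<in>S. Suc t - a i"
    \<comment> \<open>Raising one depth lowers the total remaining depth by exactly one, so this
      total counts the uses of \<open>delta_small_step\<close>.\<close>
    have rest: "(\<Sum>i\<in>S. Suc t - (a(l := Suc (a l))) i) + 1 = ?n" if "l \<in> S" for l
    proof -
      have "(\<Sum>i\<in>S - {l}. Suc t - (a(l := Suc (a l))) i) = (\<Sum>i\<in>S - {l}. Suc t - a i)"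
        by (rule sum.cong) auto
      then show ?thesis
        using lt that by (simp add: sum.remove [OF finS that] Suc_diff_le less_Suc_eq_le)
    qed
    have n: "?n = Suc (?n - 1)" using rest [OF j(1)] by simp
    have "delta_small G k m (Suc (s + (?n - 1))) (?M a)"
    proof (rule delta_small_step [OF M S(1) [OF j(1)]])
      have "delta_values G k (?M a) \<subseteq> delta_values G k N"
        using sub by (rule delta_values_mono)
      then show "finite (delta_values G k (?M a))" "card (delta_values G k (?M a)) \<le> m"
        using fin by (meson card_mono finite_subset order_trans)+
      fix l :: nat assume l: "l \<in> {1..2 ^ k}"
      let ?C = "comm_subgroup G (?M a l) (?M a j)"
      show "delta_small G k m (s + (?n - 1)) ((?M a)(l := ?C))"
      proof (cases "l \<in> S")
        case True
        let ?a = "a(l := Suc (a l))"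
        have "?C \<subseteq> chain_term A (N l) (Suc (a l))"
          using comm_chain_term [OF A Nn [OF l]] True j(1) max aj by simp
        then have sub': "delta_subgroup G k ((?M a)(l := ?C)) \<subseteq> delta_subgroup G k (?M ?a)"
          using True by (intro delta_subgroup_mono) auto
        have small: "delta_small G k m (s + (\<Sum>i\<in>S. Suc t - ?a i)) (?M ?a)"
        proof (rule less.hyps)
          show "(\<Sum>i\<in>S. Suc t - ?a i) < ?n" using rest [OF True] by simp
          show "\<exists>i\<in>S. 1 \<le> ?a i" using True by (intro bexI [of _ l]) simp_all
          show "\<forall>i\<in>S. ?a i \<le> Suc t" using lt by (auto simp: Suc_le_eq intro: less_imp_le)
        qed
        have "(\<Sum>i\<in>S. Suc t - ?a i) = ?n - 1" using rest [OF True] by simp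
        with delta_small_subset [OF small sub'] show ?thesis by (simp only:)
      next
        case False
        \<comment> \<open>An entry outside S has no chain. Its commutator with the j-th entry still
          lies in A, because 1 \<le> a j, and \<open>out\<close> applies.\<close>
        have "?C \<subseteq> N l \<inter> A"
        proof -
          have Mj: "?M a j \<lhd> G" using M S(1) [OF j(1)] by (simp add: normal_tuple_def)
          obtain u where "a j = Suc u" using aj by (cases "a j") auto
          then have "?M a j \<subseteq> A"
            using j(1) derived_term_subset [OF A] by (simp add: chain_term_def)
          then show ?thesis
            using comm_subgroup_subset [OF Nn [OF l] Mj] False by auto
        qed
        then have "delta_subgroup G k ((?M a)(l := ?C)) \<subseteq> delta_subgroup G k (N(l := N l \<inter> A))"
          using sub by (intro delta_subgroup_mono) auto
        then have "delta_small G k m s ((?M a)(l := ?C))"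
          by (rule delta_small_subset [OF out, rotated]) (use l False in simp)
        then show ?thesis by (rule delta_small_mono) simp
      qed
    qed
    moreover have "s + ?n = Suc (s + (?n - 1))" using n by linarith
    ultimately show ?thesis by (simp only:)
  qed
qed

text \<open>Downward induction on the set \<open>S = {i. A \<subseteq> N i}\<close>, which grows when \<open>A\<close> is replaced by \<open>N p \<inter> A\<close>
  with \<open>p \<notin> S\<close>. The end of the chain is harmless: if \<open>S\<close> is everything, then \<open>A\<^sup>(\<^sup>k\<^sup>+\<^sup>1\<^sup>)\<close> lies in the
  derived subgroup of \<open>\<delta>\<^sub>k(N)\<close>, and otherwise the three subgroups lemma pushes \<open>A\<^sup>(\<^sup>k\<^sup>+\<^sup>1\<^sup>)\<close> from the
  \<open>l\<close>-th entry into the entries outside \<open>S\<close>.\<close>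

lemma delta_small_update:
  assumes N: "normal_tuple G k N"
    and fin: "finite (delta_values G k N)" "card (delta_values G k N) = m"
    and "A \<lhd> G" "l \<in> {1..2 ^ k}" "A \<subseteq> N l"
  shows "delta_small G k m ((2 ^ k - card {i \<in> {1..2 ^ k}. A \<subseteq> N i}) * (2 ^ k * (k + 2) + 1) + 2 ^ k * (k + 2))
    (N(l := A))"
  using assms(4-)
proof (induction "2 ^ k - card {i \<in> {1..2 ^ k}. A \<subseteq> N i}" arbitrary: A l rule: less_induct)
  case less
  define S where "S = {i \<in> {1..2 ^ k}. A \<subseteq> N i}"
  define d where "d = 2 ^ k - card S"
  define c where "c = 2 ^ k * (k + 2)"
  have Nn: "N i \<lhd> G" if "i \<in> {1..2 ^ k}" for i using N that by (simp add: normal_tuple_def)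
  note A = \<open>A \<lhd> G\<close>
  note nD = normal_derived_term [OF A]
  have finS: "finite S" and SU: "S \<subseteq> {1..2 ^ k}" by (auto simp: S_def)
  have lS: "l \<in> S" using less.prems by (simp add: S_def)
  have out: "d \<noteq> 0 \<and> delta_small G k m ((d - 1) * (c + 1) + c) (N(p := N p \<inter> A))"
    if p: "p \<in> {1..2 ^ k} - S" for p
  proof -
    let ?S = "{i \<in> {1..2 ^ k}. N p \<inter> A \<subseteq> N i}"
    have "insert p S \<subseteq> ?S" using p by (auto simp: S_def)
    then have "card (insert p S) \<le> card ?S" by (intro card_mono) auto
    then have S': "card S < card ?S" using p finS by simp
    have "card ?S \<le> card {1..2 ^ k :: nat}" by (intro card_mono) auto
    then have lt: "2 ^ k - card ?S < d" "2 ^ k - card ?S \<le> d - 1" "d \<noteq> 0" using S' by (auto simp: d_def)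
    have "delta_small G k m ((2 ^ k - card ?S) * (c + 1) + c) (N(p := N p \<inter> A))"
      unfolding c_def using lt(1) Nn A p
      by (intro less.hyps normal_subgroup_intersect) (auto simp: d_def S_def)
    moreover have "(2 ^ k - card ?S) * (c + 1) + c \<le> (d - 1) * (c + 1) + c"
      using lt(2) by (intro add_mono mult_le_mono) auto
    ultimately show ?thesis using delta_small_mono lt(3) by blast
  qed
  \<comment> \<open>The extra step is the one that \<open>delta_small_refined\<close> spends at the
    deep end.\<close>
  have ds: "d * (c + 1) = Suc ((d - 1) * (c + 1) + c)" if "d \<noteq> 0"
    using that by (cases d) auto
  have deep: "delta_small G k m (d * (c + 1)) (N(i := derived_term G A (Suc k)))" if i: "i \<in> S" for i
  proof (cases "S = {1..2 ^ k}")
    case True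
    let ?W = "delta_subgroup G k N"
    \<comment> \<open>This case fixes the depth k + 1: A^(k) lies in W, and one further derivation
      reaches W'.\<close>
    have "derived_term G A k \<subseteq> ?W"
      using True by (intro derived_term_subset_delta [OF A N]) (auto simp: S_def)
    then have "derived_term G A (Suc k) \<subseteq> comm_subgroup G ?W ?W" by (simp add: comm_subgroup_mono)
    moreover have "i \<in> {1..2 ^ k}" using i SU by blast
    then have "delta_subgroup G k (N(i := derived_term G A (Suc k))) \<subseteq> derived_term G A (Suc k)"
      using delta_subgroup_subset [OF normal_tuple_update [OF N nD], of i i "Suc k"] by simp
    ultimately have sub: "delta_subgroup G k (N(i := derived_term G A (Suc k))) \<subseteq> comm_subgroup G ?W ?W"
      by (meson order_trans)
    have "finite (comm_subgroup G ?W ?W) \<and> card (comm_subgroup G ?W ?W) \<le> schur_bound m"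
      unfolding word_subgroup_def
      using delta_values_conj [OF N] fin by (intro finite_derived_generate)
    then have "delta_small G k m 0 (N(i := derived_term G A (Suc k)))"
      unfolding delta_small_def iter_bound_def funpow_0
      using finite_subset [OF sub] card_mono [OF _ sub] order_trans by blast
    then show ?thesis by (rule delta_small_mono) simp
  next
    case False
    then obtain q where q: "q \<in> {1..2 ^ k} - S" using SU by blast
    \<comment> \<open>Containment of N p \<inter> A is demanded only outside S; the trivial subgroup
      at the other entries makes their factors trivial, hence small at every stage.\<close>
    define Y where "Y p = (if p \<in> S then {\<one>} else N p \<inter> A)" for p
    have Y: "normal_tuple G k Y"
      unfolding normal_tuple_def Y_def using Nn A one_is_normal by (simp add: normal_subgroup_intersect)
    have "delta_small G k m (Suc ((d - 1) * (c + 1) + c)) (N(i := derived_term G A (Suc k)))"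
    proof (rule delta_small_refined [OF N Y])
      fix p :: nat assume p: "p \<in> {1..2 ^ k}"
      show "delta_small G k m ((d - 1) * (c + 1) + c) (N(p := Y p))"
      proof (cases "p \<in> S")
        case True
        have "delta_subgroup G k (N(p := {\<one>})) \<subseteq> {\<one>}"
          using delta_subgroup_subset [OF normal_tuple_update [OF N one_is_normal] p, of p] by simp
        then have "finite (delta_subgroup G k (N(p := {\<one>})))" "card (delta_subgroup G k (N(p := {\<one>}))) \<le> 1"
          using finite_subset card_mono [of "{\<one>}"] by fastforce+
        then show ?thesis
          using True order_trans [OF _ iter_bound_pos] by (simp add: delta_small_def Y_def)
      next
        case False
        then show ?thesis using out p by (simp add: Y_def)
      qed
    next
      show "delta_subgroup G k (N(i := derived_term G A (Suc k))) \<subseteq> refined_subgroup G k N Y"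
        using q i by (intro delta_subgroup_derived_update A N Y) (auto simp: S_def Y_def)
    qed
    then show ?thesis using ds [OF out [OF q, THEN conjunct1]] by (simp only:)
  qed
  \<comment> \<open>Depth 1 at l and 0 elsewhere: the chain tuple is N(l := A) itself.\<close>
  define a where "a = (\<lambda>i. if i = l then 1 else 0 :: nat)"
  have "delta_small G k m (d * (c + 1) + (\<Sum>i\<in>S. Suc (Suc k) - a i))
      (\<lambda>i. if i \<in> S then chain_term A (N i) (a i) else N i)"
    unfolding S_def
  proof (rule delta_small_chain [OF N A fin(1)])
    show "card (delta_values G k N) \<le> m" using fin(2) by simp
    show "delta_small G k m (d * (c + 1)) (N(p := N p \<inter> A))"
      if "p \<in> {1..2 ^ k} - {i \<in> {1..2 ^ k}. A \<subseteq> N i}" for p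
    proof -
      have o: "d \<noteq> 0 \<and> delta_small G k m ((d - 1) * (c + 1) + c) (N(p := N p \<inter> A))"
        using out that unfolding S_def by blast
      show ?thesis
        unfolding ds [OF conjunct1 [OF o]] using conjunct2 [OF o] by (rule delta_small_mono) simp
    qed
    show "delta_small G k m (d * (c + 1)) (N(i := derived_term G A (Suc k)))"
      if "i \<in> {i \<in> {1..2 ^ k}. A \<subseteq> N i}" for i
      using deep that by (simp add: S_def)
    show "\<exists>i\<in>{i \<in> {1..2 ^ k}. A \<subseteq> N i}. 1 \<le> a i"
      using lS by (intro bexI [of _ l]) (simp_all add: a_def S_def)
    show "\<forall>i\<in>{i \<in> {1..2 ^ k}. A \<subseteq> N i}. a i \<le> Suc (Suc k)" by (simp add: a_def)
  qed
  moreover have "(\<lambda>i. if i \<in> S then chain_term A (N i) (a i) else N i) = N(l := A)"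
    using lS by (auto simp: fun_eq_iff a_def chain_term_def)
  moreover have "(\<Sum>i\<in>S. Suc (Suc k) - a i) \<le> c"
  proof -
    have "(\<Sum>i\<in>S. Suc (Suc k) - a i) \<le> card S * (k + 2)"
      using sum_bounded_above [of S "\<lambda>i. Suc (Suc k) - a i" "k + 2"] by simp
    also have "\<dots> \<le> c"
      unfolding c_def using card_mono [OF _ SU] by (intro mult_le_mono1) simp
    finally show ?thesis .
  qed
  ultimately have "delta_small G k m (d * (c + 1) + c) (N(l := A))"
    using delta_small_mono by (metis add_left_mono)
  then show ?case by (simp only: d_def S_def c_def)
qed

theorem delta_subgroup_order_bound:
  assumes "normal_tuple G k N" "finite (delta_values G k N)" "card (delta_values G k N) = m"
  shows "finite (delta_subgroup G k N) \<and> card (delta_subgroup G k N) \<le> order_bound m k"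
proof -
  have "N 1 \<lhd> G" "(1::nat) \<in> {1..2 ^ k}" using assms(1) by (simp_all add: normal_tuple_def)
  \<comment> \<open>The choice A = N 1 and l = 1 leaves the tuple unchanged.\<close>
  then have "delta_small G k m ((2 ^ k - card {i \<in> {1..2 ^ k}. N 1 \<subseteq> N i}) * (2 ^ k * (k + 2) + 1) + 2 ^ k * (k + 2))
      (N(1 := N 1))"
    using assms by (intro delta_small_update) auto
  then have "delta_small G k m (2 ^ k * (2 ^ k * (k + 2) + 1) + 2 ^ k * (k + 2)) (N(1 := N 1))"
    by (rule delta_small_mono) (intro add_mono mult_le_mono; simp)
  then show ?thesis by (simp add: delta_small_def order_bound_def)
qed

section \<open>Uniformity in the group\<close>


lemma countable_generate:
  assumes "countable S" "S \<subseteq> carrier G"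
  shows "countable (generate G S)"
proof -
  let ?Y = "S \<union> m_inv G ` S"
  have "generate G ?Y = {list_mult xs | xs. set xs \<subseteq> ?Y}"
    using assms(2) by (intro generate_eq_list_mult) auto
  then have "generate G ?Y = list_mult ` lists ?Y" by (auto simp: lists_eq_set)
  moreover have "generate G S \<subseteq> generate G ?Y" by (intro mono_generate) simp
  ultimately show ?thesis
    using assms(1) by (metis countable_Un countable_image countable_lists countable_subset)
qed

text \<open>Finitely many values need only finitely many arguments. The group they generate is
  countable, yet still sees every value.\<close>

lemma word_values_witnesses:
  assumes "finite (word_values G w r N)" "\<And>i. i \<in> {1..r} \<Longrightarrow> N i \<subseteq> carrier G"
  obtains F where "finite F" "F \<subseteq> carrier G"
    "\<And>x. x \<in> word_values G w r N \<Longrightarrow> \<exists>g. x = geval G g w \<and> (\<forall>i\<in>{1..r}. g i \<in> N i \<inter> F)"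
proof -
  have ex: "\<forall>x\<in>word_values G w r N. \<exists>g. x = geval G g w \<and> (\<forall>i\<in>{1..r}. g i \<in> N i)"
    unfolding word_values_def by blast
  obtain g where g: "\<forall>x\<in>word_values G w r N. x = geval G (g x) w \<and> (\<forall>i\<in>{1..r}. g x i \<in> N i)"
    using bchoice [OF ex] by blast
  show thesis
  proof (rule that)
    let ?F = "\<Union>x\<in>word_values G w r N. g x ` {1..r}"
    show "finite ?F" using assms(1) by simp
    show "?F \<subseteq> carrier G" using g assms(2) by blast
    show "\<exists>g. x = geval G g w \<and> (\<forall>i\<in>{1..r}. g i \<in> N i \<inter> ?F)" if "x \<in> word_values G w r N" for x
      using g that by (intro exI [of _ "g x"]) blast
  qed
qed

end

lemma (in group_hom) hom_geval:
  assumes "\<And>i. i \<in> set_gword w \<Longrightarrow> g i \<in> carrier G"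
  shows "geval G g w \<in> carrier G \<and> h (geval G g w) = geval H (\<lambda>i. h (g i)) w"
  using assms by (induction w) auto

lemma (in group_hom) normal_preimage:
  assumes "M \<lhd> H"
  shows "{x \<in> carrier G. h x \<in> M} \<lhd> G"
proof -
  interpret M: normal M H by fact
  show ?thesis
    by (rule G.normal_invI, rule G.subgroupI)
      (auto simp: M.inv_op_closed2 intro: exI [of _ "\<one>"])
qed

text \<open>\<open>order_bound\<close> shows that the choice defining \<open>delta_bound\<close> has
  a candidate. The chosen function may differ from it, so only its property for groups on
  \<open>nat\<close> is available.\<close>

lemma bounds_delta_orders_nat: "bounds_delta_orders TYPE(nat) delta_bound"
proof -
  have "bounds_delta_orders TYPE(nat) order_bound"
    unfolding bounds_delta_orders_def
    using group.delta_subgroup_order_bound unfolding normal_tuple_def by blast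
  then show ?thesis unfolding delta_bound_def by (rule someI [of "bounds_delta_orders TYPE(nat)"])
qed

text \<open>The values of \<open>\<delta>\<^sub>k\<close> are already attained on a countable subgroup, which has a copy with
  carrier in the natural numbers.\<close>

theorem corollary3p8:
  fixes G :: "('a, 'b) monoid_scheme" and N :: "nat \<Rightarrow> 'a set" and k m :: nat
  assumes "group G"
    and "k \<ge> 1"
    and "\<forall>i\<in>{1..2 ^ k}. N i \<lhd> G"
    and "finite (word_values G (delta_word k) (2 ^ k) N)"
    and "card (word_values G (delta_word k) (2 ^ k) N) = m"
  shows "finite (word_subgroup G (delta_word k) (2 ^ k) N) \<and>
         card (word_subgroup G (delta_word k) (2 ^ k) N) \<le> delta_bound m k"
proof -
  interpret group G by fact
  have Nc: "N i \<subseteq> carrier G" if "i \<in> {1..2 ^ k}" for i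
    using assms(3) that normal_carrier by blast
  obtain F where F: "finite F" "F \<subseteq> carrier G"
    "\<And>x. x \<in> delta_values G k N \<Longrightarrow>
      \<exists>g. x = geval G g (delta_word k) \<and> (\<forall>i\<in>{1..2 ^ k}. g i \<in> N i \<inter> F)"
    using word_values_witnesses [OF assms(4) Nc] by blast
  define C where "C = generate G F"
  have C: "subgroup C G" unfolding C_def using F(2) by (rule generate_is_subgroup)
  have "countable C"
    unfolding C_def using F(1,2) by (intro countable_generate countable_finite)
  then have inj: "inj_on (to_nat_on C) (carrier (G\<lparr>carrier := C\<rparr>))"
    by (simp add: inj_on_to_nat_on)
  let ?GC = "G\<lparr>carrier := C\<rparr>"
  interpret C: group ?GC using C by (rule subgroup_imp_group)
  \<comment> \<open>The copy of C with elements in \<open>nat\<close>, to which the property of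
    \<open>delta_bound\<close> applies; e maps it back into G.\<close>
  define H where "H = image_group (to_nat_on C) ?GC"
  have "group H" unfolding H_def using inj by (rule C.inj_imp_image_group_is_group)
  define e where "e = inv_into C (to_nat_on C)"
  have iso: "e \<in> iso H ?GC"
    using C.iso_set_sym [OF inj_imp_image_group_iso [OF inj]] by (simp add: e_def H_def)
  then have inj_e: "inj_on e (carrier H)" and im_e: "e ` carrier H = C" and "e \<in> hom H ?GC"
    by (auto simp: iso_def bij_betw_def)
  then have "e \<in> hom H G"
    using subgroup.subset [OF C] by (auto simp: hom_def)
  then interpret e: group_hom H G e
    using \<open>group H\<close> by (simp add: group_hom_def group_hom_axioms_def group_axioms)
  \<comment> \<open>Preimages of normal subgroups are normal although e need not be onto; up to e
    these are the subgroups N i \<inter> C.\<close>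
  define M where "M i = {x \<in> carrier H. e x \<in> N i}" for i
  have M: "\<forall>i\<in>{1..2 ^ k}. M i \<lhd> H"
    using assms(3) e.normal_preimage by (simp add: M_def)
  have ev: "geval H g (delta_word k) \<in> carrier H \<and>
      e (geval H g (delta_word k)) = geval G (\<lambda>i. e (g i)) (delta_word k)"
    if "\<forall>i\<in>{1..2 ^ k}. g i \<in> carrier H" for g
    using that set_delta_word [of k] by (intro e.hom_geval) blast
  have Mc: "delta_values H k M \<subseteq> carrier H"
    unfolding word_values_def using ev by (auto simp: M_def)
  \<comment> \<open>Passing to C could lose values; the witnesses in F \<subseteq> C lift to H and
    give the inclusion from right to left.\<close>
  have im_values: "e ` delta_values H k M = delta_values G k N"
  proof (intro equalityI subsetI)
    fix x assume "x \<in> e ` delta_values H k M"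
    then obtain g where g: "x = e (geval H g (delta_word k))" "\<forall>i\<in>{1..2 ^ k}. g i \<in> M i"
      unfolding word_values_def by blast
    then have "x = geval G (\<lambda>i. e (g i)) (delta_word k)" using ev [of g] by (simp add: M_def)
    then show "x \<in> delta_values G k N"
      unfolding word_values_def using g(2)
      by (intro CollectI exI [of _ "\<lambda>i. e (g i)"]) (simp add: M_def)
  next
    fix x assume "x \<in> delta_values G k N"
    then obtain g where g: "x = geval G g (delta_word k)" "\<forall>i\<in>{1..2 ^ k}. g i \<in> N i \<inter> F"
      using F(3) by blast
    have ex: "\<forall>i\<in>{1..2 ^ k}. \<exists>y. y \<in> carrier H \<and> e y = g i"
    proof
      fix i :: nat assume "i \<in> {1..2 ^ k}"
      then have "g i \<in> e ` carrier H" unfolding im_e C_def using g(2) generate.incl by fastforce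
      then show "\<exists>y. y \<in> carrier H \<and> e y = g i" by auto
    qed
    obtain f where f: "\<forall>i\<in>{1..2 ^ k}. f i \<in> carrier H \<and> e (f i) = g i"
      using bchoice [OF ex] by blast
    have "e (geval H f (delta_word k)) = geval G (\<lambda>i. e (f i)) (delta_word k)" using ev [of f] f by blast
    also have "\<dots> = x" unfolding g(1) using f by (intro geval_delta_cong) blast
    finally have "x = e (geval H f (delta_word k))" by simp
    moreover have "geval H f (delta_word k) \<in> delta_values H k M"
      unfolding word_values_def using f g(2) by (intro CollectI exI [of _ f]) (simp add: M_def)
    ultimately show "x \<in> e ` delta_values H k M" by (rule image_eqI)
  qed
  have injM: "inj_on e (delta_values H k M)" using inj_e Mc by (rule inj_on_subset)
  have "finite (delta_values H k M)"
    using assms(4) injM by (simp add: im_values [symmetric] finite_image_iff)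
  moreover have "card (delta_values H k M) = m"
    using assms(5) injM by (simp add: im_values [symmetric] card_image)
  ultimately have "finite (delta_subgroup H k M) \<and> card (delta_subgroup H k M) \<le> delta_bound m k"
    using bounds_delta_orders_nat \<open>group H\<close> assms(2) M unfolding bounds_delta_orders_def by blast
  moreover have "delta_subgroup G k N = e ` delta_subgroup H k M"
    unfolding word_subgroup_def im_values [symmetric] using Mc by (rule e.generate_img)
  ultimately show ?thesis by (simp add: card_image_le order_trans [OF card_image_le])
qed

end
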